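(* Let $n\ge 1$ and let $G$ be a loopless graph on the vertex set $[n+1]$ in which the only edges allowed to have multiplicity greater than $1$ are those of the form $(1,l)$. For $i\in[n-1]$ let $c_i=|E(G[i+1])|-|E(G[i])|$. The normalized volume $\operatorname{vol}(\mathcal{F}_{\tilde G})$ is equal to $$CT_{x_n}\cdots CT_{x_1}\ \prod_{i=1}^n(1-x_i)^{-1}\prod_{(i,n+1)\in E(G)}(1-x_i)^{-1}\prod_{i=2}^n x_i^{-c_{i-1}}\prod_{(i,j)\in E(G):\ j\le n}\Big(1-\frac{x_i}{x_j}\Big)^{-1}.$$
   Context: $CT_{x_i}$ means taking the constant term in the expansion in the variable $x_i$; the product is viewed as a formal Laurent series in which $(1-x_i)^{-1}=\sum_{k\ge0}x_i^k$ and, for $i<j$, $(1-x_i/x_j)^{-1}=\sum_{k\ge0}(x_i/x_j)^k$. The operators are applied in the order $CT_{x_1}$ first, $CT_{x_n}$ last. Graphs may have multiple edges (distinct parallel edges are different elements of the edge multiset); vertex sets are totally ordered; an edge is written $(i,j)$ with $i<j$, $i$ being its initial and $j$ its final vertex. $[N]=\{1,\dots,N\}$. $G[i]$ is the restriction of $G$ to the vertex set $[i]$, and $|E(\cdot)|$ counts edges with multiplicity. For $G=([n+1],E)$, $\tilde G$ is the graph on $[n+1]\cup\{s,t\}$, with $s$ smaller and $t$ larger than all of $[n+1]$, and edge multiset $E\cup\{(s,i),(i,t): i\in[n+1]\}$. The flow polytope $\mathcal{F}_H$ of a graph $H$ with smallest vertex $s$ and largest vertex $t$ is the set of functions $f:E(H)\to\mathbb{R}_{\ge0}$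 such that the total $f$-value of edges with initial vertex $s$ is $1$, the total $f$-value of edges with final vertex $t$ is $1$, and at every other vertex the total incoming $f$-value equals the total outgoing $f$-value. $\operatorname{vol}$ is normalized volume (with respect to the integer lattice in the affine hull, a unimodular simplex having volume $1$). *)

theory Defs
  imports "HOL-Analysis.Analysis" "HOL-Analysis.Finite_Function_Topology"
    "HOL-Library.Multiset"
begin

section \<open>Formal Laurent series in the ordered variables x_0, x_1, x_2, ...\<close>

text \<open>
  An exponent vector is a finitely supported function \<open>a\<close> from variable indices to integers.
  The monomials \<open>x_i\<close> and \<open>x_i / x_j\<close> with \<open>i < j\<close> generate the monoid of
  exponent vectors all of whose partial sums \<open>a_0 + ... + a_k\<close> are nonnegative.  A formal series
  is admitted if it involves finitely many variables and the partial sums of its exponents are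
  bounded below.  The usual convolution product is then a finite sum in every degree, and the
  expansions of \<open>1 / (1 - x_i)\<close> in powers of \<open>x_i\<close> and of \<open>1 / (1 - x_i / x_j)\<close> in powers of
  \<open>x_i / x_j\<close> are admitted.
\<close>

type_synonym expo = "nat \<Rightarrow>\<^sub>0 int"

definition psum :: "expo \<Rightarrow> nat \<Rightarrow> int" where
  "psum a k = (\<Sum>i\<le>k. Poly_Mapping.lookup a i)"

definition expo_bounded :: "nat \<Rightarrow> expo \<Rightarrow> bool" where
  "expo_bounded N a \<longleftrightarrow> Poly_Mapping.keys a \<subseteq> {..N} \<and> (\<forall>k. - int N \<le> psum a k)"

lemma psum_add: "psum (a + b) k = psum a k + psum b k"
  by (simp add: psum_def lookup_add sum.distrib)

lemma psum_diff: "psum (a - b) k = psum a k - psum b k"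
  by (simp add: psum_def lookup_minus sum_subtractf)

lemma psum_0 [simp]: "psum 0 k = 0"
  by (simp add: psum_def)

lemma expo_bounded_mono: "expo_bounded M a \<Longrightarrow> M \<le> N \<Longrightarrow> expo_bounded N a"
  unfolding expo_bounded_def
  by (meson atMost_subset_iff neg_le_iff_le of_nat_le_iff order_trans)

lemma expo_bounded_add:
  assumes "expo_bounded M a" "expo_bounded N b"
  shows "expo_bounded (M + N) (a + b)"
proof -
  have "Poly_Mapping.keys (a + b) \<subseteq> {..M + N}"
    using keys_add[of a b] assms unfolding expo_bounded_def by fastforce
  moreover have "- int (M + N) \<le> psum (a + b) k" for k
  proof -
    have "- int M \<le> psum a k" "- int N \<le> psum b k"
      using assms by (auto simp: expo_bounded_def)
    then show ?thesis by (simp add: psum_add)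
  qed
  ultimately show ?thesis by (simp add: expo_bounded_def)
qed

lemma expo_eqI:
  assumes "\<And>k. psum a k = psum b k"
  shows "a = b"
proof (rule poly_mapping_eqI)
  fix i
  show "Poly_Mapping.lookup a i = Poly_Mapping.lookup b i"
  proof (cases i)
    case 0
    then show ?thesis using assms[of 0] by (simp add: psum_def)
  next
    case (Suc j)
    then show ?thesis using assms[of i] assms[of j] by (simp add: psum_def)
  qed
qed

lemma psum_beyond:
  assumes "Poly_Mapping.keys a \<subseteq> {..N}" "N \<le> k"
  shows "psum a k = psum a N"
  unfolding psum_def
  by (rule sum.mono_neutral_right) (use assms in \<open>auto simp: in_keys_iff\<close>)

definition window :: "nat \<Rightarrow> expo \<Rightarrow> expo set" where
  "window N c = {a. expo_bounded N a \<and> expo_bounded N (c - a)}"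

lemma finite_window [simp]: "finite (window N c)"
proof (rule finite_imageD)
  let ?f = "\<lambda>a. restrict (psum a) {..N}"
  show "inj_on ?f (window N c)"
  proof (rule inj_onI)
    fix a b assume a: "a \<in> window N c" and b: "b \<in> window N c" and eq: "?f a = ?f b"
    have low: "psum a k = psum b k" if "k \<le> N" for k
      using fun_cong[OF eq, of k] that by simp
    have "psum a k = psum b k" for k
    proof (cases "k \<le> N")
      case False
      then show ?thesis
        using psum_beyond[of a N k] psum_beyond[of b N k] a b low[of N]
        by (simp add: window_def expo_bounded_def)
    qed (rule low)
    then show "a = b" by (rule expo_eqI)
  qed
  have "?f ` window N c \<subseteq> (\<Pi>\<^sub>E k\<in>{..N}. {- int N .. psum c k + int N})"
  proof (intro image_subsetI PiE_I)
    fix a k assume "a \<in> window N c" "k \<in> {..N}"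
    then have "- int N \<le> psum a k" "- int N \<le> psum (c - a) k"
      by (auto simp: window_def expo_bounded_def)
    then show "?f a k \<in> {- int N .. psum c k + int N}"
      using \<open>k \<in> {..N}\<close> by (simp add: psum_diff)
  qed auto
  then show "finite (?f ` window N c)"
    by (rule finite_subset) (simp add: finite_PiE)
qed

typedef (overloaded) 'a laurent =
  "{F :: expo \<Rightarrow> 'a::zero. \<exists>N. \<forall>a. F a \<noteq> 0 \<longrightarrow> expo_bounded N a}"
  morphisms lcoeff Abs_laurent
  by (rule exI[of _ "\<lambda>_. 0"]) simp

setup_lifting type_definition_laurent
lifting_forget poly_mapping.lifting

lemma laurent_eqI: "(\<And>a. lcoeff F a = lcoeff G a) \<Longrightarrow> F = G"
  by (simp add: lcoeff_inject[symmetric] fun_eq_iff)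

lemma laurent_bound:
  obtains N where "\<And>a. lcoeff F a \<noteq> 0 \<Longrightarrow> expo_bounded N a"
  using lcoeff[of F] by blast

lemma conv_window:
  fixes F G :: "expo \<Rightarrow> 'a::semiring_0"
  assumes "\<And>a. F a \<noteq> 0 \<Longrightarrow> expo_bounded N a" "\<And>a. G a \<noteq> 0 \<Longrightarrow> expo_bounded N a"
  shows "(\<Sum>a | F a \<noteq> 0 \<and> G (c - a) \<noteq> 0. F a * G (c - a)) = (\<Sum>a\<in>window N c. F a * G (c - a))"
proof (rule sum.mono_neutral_left)
  show "{a. F a \<noteq> 0 \<and> G (c - a) \<noteq> 0} \<subseteq> window N c"
    using assms by (auto simp: window_def)
qed auto

lift_definition lmonom :: "expo \<Rightarrow> 'a::zero_neq_one laurent"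
  is "\<lambda>a b. if b = a then 1 else 0"
proof -
  fix a :: expo
  obtain M where M: "Poly_Mapping.keys a \<subseteq> {..M}"
    using finite_nat_iff_bounded_le finite_keys by blast
  define L where "L = nat (Max ((\<lambda>k. \<bar>psum a k\<bar>) ` {..M}))"
  have "- int L \<le> psum a k" for k
  proof -
    have "psum a k = psum a (min k M)"
      using psum_beyond[OF M, of k] by (cases "k \<le> M") auto
    moreover have "\<bar>psum a (min k M)\<bar> \<le> Max ((\<lambda>k. \<bar>psum a k\<bar>) ` {..M})"
      by (rule Max_ge) auto
    moreover have "Max ((\<lambda>k. \<bar>psum a k\<bar>) ` {..M}) \<le> int L"
      unfolding L_def by linarith
    ultimately show ?thesis by linarith
  qed
  then have "- int (M + L) \<le> psum a k" for k
    by (metis add.commute le_add1 neg_le_iff_le of_nat_le_iff order_trans)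
  with M have "expo_bounded (M + L) a" unfolding expo_bounded_def by force
  then show "\<exists>N. \<forall>b. (if b = a then 1 else 0::'a) \<noteq> 0 \<longrightarrow> expo_bounded N b"
    by auto
qed

instantiation laurent :: (comm_ring_1) comm_ring_1
begin

lift_definition zero_laurent :: "'a laurent" is "\<lambda>_. 0" by simp

definition one_laurent :: "'a laurent" where "1 = lmonom 0"

lift_definition plus_laurent :: "'a laurent \<Rightarrow> 'a laurent \<Rightarrow> 'a laurent"
  is "\<lambda>F G a. F a + G a"
proof -
  fix F G :: "expo \<Rightarrow> 'a"
  assume "\<exists>N. \<forall>a. F a \<noteq> 0 \<longrightarrow> expo_bounded N a" "\<exists>N. \<forall>a. G a \<noteq> 0 \<longrightarrow> expo_bounded N a"
  then obtain M N where "\<forall>a. F a \<noteq> 0 \<longrightarrow> expo_bounded M a" "\<forall>a. G a \<noteq> 0 \<longrightarrow> expo_bounded N a"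
    by blast
  then have "\<forall>a. F a + G a \<noteq> 0 \<longrightarrow> expo_bounded (max M N) a"
    by (metis add_0 expo_bounded_mono max.cobounded1 max.cobounded2)
  then show "\<exists>N. \<forall>a. F a + G a \<noteq> 0 \<longrightarrow> expo_bounded N a" ..
qed

lift_definition uminus_laurent :: "'a laurent \<Rightarrow> 'a laurent" is "\<lambda>F a. - F a" by simp

definition minus_laurent :: "'a laurent \<Rightarrow> 'a laurent \<Rightarrow> 'a laurent"
  where "F - G = F + - (G :: 'a laurent)"

lift_definition times_laurent :: "'a laurent \<Rightarrow> 'a laurent \<Rightarrow> 'a laurent"
  is "\<lambda>F G c. \<Sum>a | F a \<noteq> 0 \<and> G (c - a) \<noteq> 0. F a * G (c - a)"
proof -
  fix F G :: "expo \<Rightarrow> 'a"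
  assume "\<exists>N. \<forall>a. F a \<noteq> 0 \<longrightarrow> expo_bounded N a" "\<exists>N. \<forall>a. G a \<noteq> 0 \<longrightarrow> expo_bounded N a"
  then obtain M N where b: "\<forall>a. F a \<noteq> 0 \<longrightarrow> expo_bounded M a" "\<forall>a. G a \<noteq> 0 \<longrightarrow> expo_bounded N a"
    by blast
  have "expo_bounded (M + N) c"
    if nz: "(\<Sum>a | F a \<noteq> 0 \<and> G (c - a) \<noteq> 0. F a * G (c - a)) \<noteq> 0" for c
  proof -
    obtain a where "F a \<noteq> 0" "G (c - a) \<noteq> 0"
    proof (atomize_elim, rule ccontr)
      assume "\<nexists>a. F a \<noteq> 0 \<and> G (c - a) \<noteq> 0"
      then have "{a. F a \<noteq> 0 \<and> G (c - a) \<noteq> 0} = {}" by blast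
      with nz show False by (simp only: sum.empty) simp
    qed
    then show ?thesis using expo_bounded_add[of M a N "c - a"] b by simp
  qed
  then show "\<exists>N. \<forall>c. (\<Sum>a | F a \<noteq> 0 \<and> G (c - a) \<noteq> 0. F a * G (c - a)) \<noteq> 0 \<longrightarrow> expo_bounded N c"
    by blast
qed

lemma coeff_times_window:
  fixes F G :: "'a laurent"
  assumes "\<And>a. lcoeff F a \<noteq> 0 \<Longrightarrow> expo_bounded N a" "\<And>a. lcoeff G a \<noteq> 0 \<Longrightarrow> expo_bounded N a"
  shows "lcoeff (F * G) c = (\<Sum>a\<in>window N c. lcoeff F a * lcoeff G (c - a))"
  unfolding times_laurent.rep_eq by (rule conv_window) (use assms in auto)

lemma coeff_times_superset:
  fixes F G :: "'a laurent"
  assumes "finite A" "\<And>a. lcoeff F a \<noteq> 0 \<Longrightarrow> lcoeff G (c - a) \<noteq> 0 \<Longrightarrow> a \<in> A"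
  shows "lcoeff (F * G) c = (\<Sum>a\<in>A. lcoeff F a * lcoeff G (c - a))"
  unfolding times_laurent.rep_eq
  by (rule sum.mono_neutral_left) (use assms in auto)

lemma coeff_times_nonzero:
  fixes F G :: "'a laurent"
  assumes "lcoeff (F * G) c \<noteq> 0"
  obtains b where "lcoeff F b \<noteq> 0" "lcoeff G (c - b) \<noteq> 0"
proof (atomize_elim, rule ccontr)
  assume "\<nexists>b. lcoeff F b \<noteq> 0 \<and> lcoeff G (c - b) \<noteq> 0"
  then have "{b. lcoeff F b \<noteq> 0 \<and> lcoeff G (c - b) \<noteq> 0} = {}" by blast
  with assms show False unfolding times_laurent.rep_eq by (simp only: sum.empty) simp
qed

lemma laurent_bound3:
  fixes F G H :: "'a laurent"
  obtains N where "\<And>a. lcoeff F a \<noteq> 0 \<Longrightarrow> expo_bounded N a"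
    "\<And>a. lcoeff G a \<noteq> 0 \<Longrightarrow> expo_bounded N a" "\<And>a. lcoeff H a \<noteq> 0 \<Longrightarrow> expo_bounded N a"
proof -
  obtain N1 N2 N3 where b: "\<And>a. lcoeff F a \<noteq> 0 \<Longrightarrow> expo_bounded N1 a"
    "\<And>a. lcoeff G a \<noteq> 0 \<Longrightarrow> expo_bounded N2 a" "\<And>a. lcoeff H a \<noteq> 0 \<Longrightarrow> expo_bounded N3 a"
    using laurent_bound by metis
  show thesis
    by (rule that[of "N1 + N2 + N3"]; erule b[THEN expo_bounded_mono]) auto
qed

instance
proof
  fix F G H :: "'a laurent"
  obtain N where N: "\<And>a. lcoeff F a \<noteq> 0 \<Longrightarrow> expo_bounded N a"
    "\<And>a. lcoeff G a \<noteq> 0 \<Longrightarrow> expo_bounded N a" "\<And>a. lcoeff H a \<noteq> 0 \<Longrightarrow> expo_bounded N a"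
    by (rule laurent_bound3[of F G H]) blast
  have bprod: "expo_bounded (N + N) a"
    if "lcoeff X b \<noteq> 0" "lcoeff Y (a - b) \<noteq> 0" "X \<in> {F, G, H}" "Y \<in> {F, G, H}" for X Y a b
    using expo_bounded_add[of N b N "a - b"] that N by auto
  show "F + G + H = F + (G + H)"
    by (rule laurent_eqI) (simp add: plus_laurent.rep_eq add.assoc)
  show "F + G = G + F"
    by (rule laurent_eqI) (simp add: plus_laurent.rep_eq add.commute)
  show "0 + F = F"
    by (rule laurent_eqI) (simp add: plus_laurent.rep_eq zero_laurent.rep_eq)
  show "- F + F = 0"
    by (rule laurent_eqI) (simp add: plus_laurent.rep_eq zero_laurent.rep_eq uminus_laurent.rep_eq)
  show "F - G = F + - G"
    by (rule minus_laurent_def)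
  show "F * G = G * F"
  proof (rule laurent_eqI)
    fix c
    have FG_c: "lcoeff (F * G) c = (\<Sum>a\<in>window N c. lcoeff F a * lcoeff G (c - a))"
      by (rule coeff_times_window) (use N in auto)
    have GF_c: "lcoeff (G * F) c = (\<Sum>a\<in>window N c. lcoeff G a * lcoeff F (c - a))"
      by (rule coeff_times_window) (use N in auto)
    show "lcoeff (F * G) c = lcoeff (G * F) c"
      unfolding FG_c GF_c
      by (rule sum.reindex_bij_witness[of _ "\<lambda>a. c - a" "\<lambda>a. c - a"])
        (auto simp: window_def mult.commute)
  qed
  show "(F + G) * H = F * H + G * H"
  proof (rule laurent_eqI)
    fix c
    have sum_bound: "expo_bounded N a" if "lcoeff (F + G) a \<noteq> 0" for a
      using that N(1)[of a] N(2)[of a] by (cases "lcoeff F a = 0") (auto simp: plus_laurent.rep_eq)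
    have FH_c: "lcoeff (F * H) c = (\<Sum>a\<in>window N c. lcoeff F a * lcoeff H (c - a))"
      by (rule coeff_times_window) (use N in auto)
    have GH_c: "lcoeff (G * H) c = (\<Sum>a\<in>window N c. lcoeff G a * lcoeff H (c - a))"
      by (rule coeff_times_window) (use N in auto)
    have "lcoeff ((F + G) * H) c = (\<Sum>a\<in>window N c. lcoeff (F + G) a * lcoeff H (c - a))"
      by (rule coeff_times_window) (use N sum_bound in auto)
    also have "\<dots> = lcoeff (F * H) c + lcoeff (G * H) c"
      unfolding FH_c GH_c
      by (simp add: plus_laurent.rep_eq distrib_right sum.distrib)
    finally show "lcoeff ((F + G) * H) c = lcoeff (F * H + G * H) c"
      by (simp add: plus_laurent.rep_eq)
  qed
  show "1 * F = F"
  proof (rule laurent_eqI)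
    fix c
    have "lcoeff (1 * F) c = (\<Sum>a\<in>{0}. lcoeff 1 a * lcoeff F (c - a))"
      by (rule coeff_times_superset) (auto simp: one_laurent_def lmonom.rep_eq split: if_splits)
    then show "lcoeff (1 * F) c = lcoeff F c"
      by (simp add: one_laurent_def lmonom.rep_eq)
  qed
  show "(0 :: 'a laurent) \<noteq> 1"
  proof
    assume "(0 :: 'a laurent) = 1"
    then have "lcoeff (0 :: 'a laurent) 0 = lcoeff 1 0" by simp
    then show False by (simp add: zero_laurent.rep_eq one_laurent_def lmonom.rep_eq)
  qed
  show "F * G * H = F * (G * H)"
  proof (rule laurent_eqI)
    fix c
    let ?W = "window (N + N) c"
    have NN: "expo_bounded (N + N) a" if "expo_bounded N a" for a
      using expo_bounded_mono[OF that] by simp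
    have FG: "expo_bounded (N + N) a" if "lcoeff (F * G) a \<noteq> 0" for a
    proof (rule coeff_times_nonzero[OF that])
      fix b assume "lcoeff F b \<noteq> 0" "lcoeff G (a - b) \<noteq> 0"
      then show ?thesis by (rule bprod) auto
    qed
    have GH: "expo_bounded (N + N) a" if "lcoeff (G * H) a \<noteq> 0" for a
    proof (rule coeff_times_nonzero[OF that])
      fix b assume "lcoeff G b \<noteq> 0" "lcoeff H (a - b) \<noteq> 0"
      then show ?thesis by (rule bprod) auto
    qed
    have "lcoeff (F * G * H) c = (\<Sum>u\<in>?W. lcoeff (F * G) u * lcoeff H (c - u))"
      by (rule coeff_times_window) (use N NN FG in auto)
    also have "\<dots> = (\<Sum>u\<in>?W. \<Sum>a\<in>?W. lcoeff F a * lcoeff G (u - a) * lcoeff H (c - u))"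
    proof (rule sum.cong[OF refl])
      fix u
      show "lcoeff (F * G) u * lcoeff H (c - u) =
        (\<Sum>a\<in>?W. lcoeff F a * lcoeff G (u - a) * lcoeff H (c - u))"
      proof (cases "lcoeff H (c - u) = 0")
        case False
        have "lcoeff (F * G) u = (\<Sum>a\<in>?W. lcoeff F a * lcoeff G (u - a))"
        proof (rule coeff_times_superset)
          fix a assume a: "lcoeff F a \<noteq> 0" "lcoeff G (u - a) \<noteq> 0"
          have "expo_bounded (N + N) ((u - a) + (c - u))"
            using a False N by (intro expo_bounded_add) auto
          then show "a \<in> ?W" using a N NN by (simp add: window_def)
        qed simp
        then show ?thesis by (simp add: sum_distrib_right)
      qed simp
    qed
    also have "\<dots> = (\<Sum>a\<in>?W. \<Sum>u\<in>?W. lcoeff F a * (lcoeff G (u - a) * lcoeff H (c - u)))"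
      by (subst sum.swap) (simp add: mult.assoc)
    also have "\<dots> = (\<Sum>a\<in>?W. lcoeff F a * lcoeff (G * H) (c - a))"
    proof (rule sum.cong[OF refl])
      fix a
      show "(\<Sum>u\<in>?W. lcoeff F a * (lcoeff G (u - a) * lcoeff H (c - u))) =
        lcoeff F a * lcoeff (G * H) (c - a)"
      proof (cases "lcoeff F a = 0")
        case False
        have "lcoeff (G * H) (c - a) =
          (\<Sum>b\<in>(\<lambda>u. u - a) ` ?W. lcoeff G b * lcoeff H (c - a - b))"
        proof (rule coeff_times_superset)
          fix b assume b: "lcoeff G b \<noteq> 0" "lcoeff H (c - a - b) \<noteq> 0"
          have "expo_bounded (N + N) (a + b)"
            using b False N by (intro expo_bounded_add) auto
          moreover have "expo_bounded (N + N) (c - (a + b))"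
            using b(2) N(3) NN by (simp add: diff_diff_eq)
          ultimately have "a + b \<in> ?W" by (simp add: window_def)
          then show "b \<in> (\<lambda>u. u - a) ` ?W"
            by (intro image_eqI[of _ _ "a + b"]) simp_all
        qed simp
        also have "\<dots> = (\<Sum>u\<in>?W. lcoeff G (u - a) * lcoeff H (c - u))"
          by (subst sum.reindex) (auto simp: inj_on_def)
        finally show ?thesis by (simp add: sum_distrib_left)
      qed simp
    qed
    also have "\<dots> = lcoeff (F * (G * H)) c"
      by (rule coeff_times_window[symmetric]) (use N NN GH in auto)
    finally show "lcoeff (F * G * H) c = lcoeff (F * (G * H)) c" .
  qed
qed

end

definition const_series :: "'a::comm_ring_1 \<Rightarrow> 'a laurent" where
  "const_series r = Abs_laurent (\<lambda>a. if a = 0 then r else 0)"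

lemma coeff_const_series: "lcoeff (const_series r) a = (if a = 0 then r else 0)"
proof -
  have "expo_bounded 0 0" by (simp add: expo_bounded_def)
  then show ?thesis
    unfolding const_series_def by (subst Abs_laurent_inverse) auto
qed

text \<open>
  \<open>geom_series a\<close> is the expansion \<open>1 + x^a + x^(2a) + ...\<close> of \<open>1 / (1 - x^a)\<close>.  It is an admitted
  series only if all partial sums of \<open>a\<close> are nonnegative; otherwise the value is the dummy 0.
\<close>

lift_definition geom_series :: "expo \<Rightarrow> 'a::zero_neq_one laurent"
  is "\<lambda>a b. if (\<forall>k. 0 \<le> psum a k) \<and>
    (\<exists>m::nat. \<forall>i. Poly_Mapping.lookup b i = int m * Poly_Mapping.lookup a i) then 1 else 0"
proof -
  fix a :: expo
  obtain M where M: "Poly_Mapping.keys a \<subseteq> {..M}"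
    using finite_nat_iff_bounded_le finite_keys by blast
  have "expo_bounded M b" if pos: "\<forall>k. 0 \<le> psum a k"
    and m: "\<forall>i. Poly_Mapping.lookup b i = int m * Poly_Mapping.lookup a i" for m b
  proof -
    have "psum b k = int m * psum a k" for k
      using m by (simp add: psum_def sum_distrib_left)
    then have "0 \<le> psum b k" for k using pos by simp
    moreover have "Poly_Mapping.keys b \<subseteq> {..M}"
      using M m by (auto simp: in_keys_iff)
    ultimately show ?thesis
      unfolding expo_bounded_def by (meson neg_le_0_iff_le of_nat_0_le_iff order_trans)
  qed
  then show "\<exists>N. \<forall>b. (if (\<forall>k. 0 \<le> psum a k) \<and>
    (\<exists>m::nat. \<forall>i. Poly_Mapping.lookup b i = int m * Poly_Mapping.lookup a i)
      then 1 else 0::'a) \<noteq> 0 \<longrightarrow> expo_bounded N b"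
    by (intro exI[of _ M]) auto
qed

lemma coeff_minus: "lcoeff (F - G) a = (lcoeff F a - lcoeff G a :: 'a::comm_ring_1)"
  unfolding minus_laurent_def plus_laurent.rep_eq uminus_laurent.rep_eq by simp

lemma coeff_monom_times:
  "lcoeff (lmonom a * F) c = (lcoeff F (c - a) :: 'a::comm_ring_1)"
proof -
  have "lcoeff (lmonom a * F) c = (\<Sum>b\<in>{a}. lcoeff (lmonom a) b * lcoeff F (c - b))"
    by (rule coeff_times_superset) (auto simp: lmonom.rep_eq split: if_splits)
  then show ?thesis by (simp add: lmonom.rep_eq)
qed

lemma geom_series_inverse:
  assumes pos: "\<And>k. 0 \<le> psum a k" and "a \<noteq> 0"
  shows "(1 - lmonom a) * geom_series a = (1 :: 'a::comm_ring_1 laurent)"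
proof (rule laurent_eqI)
  fix c
  define P where "P c \<longleftrightarrow> (\<exists>m::nat. \<forall>i. Poly_Mapping.lookup c i = int m * Poly_Mapping.lookup a i)"
    for c :: expo
  have g: "lcoeff (geom_series a :: 'a laurent) c = (if P c then 1 else 0)" for c
    using pos by (simp add: geom_series.rep_eq P_def)
  have "P c \<longleftrightarrow> c = 0 \<or> P (c - a)"
  proof
    assume "P c"
    then obtain m where m: "\<And>i. Poly_Mapping.lookup c i = int m * Poly_Mapping.lookup a i"
      unfolding P_def by blast
    show "c = 0 \<or> P (c - a)"
    proof (cases m)
      case 0
      then show ?thesis using m by (auto intro: poly_mapping_eqI)
    next
      case (Suc m')
      then have "\<forall>i. Poly_Mapping.lookup (c - a) i = int m' * Poly_Mapping.lookup a i"
        using m by (simp add: lookup_minus algebra_simps)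
      then show ?thesis unfolding P_def by blast
    qed
  next
    assume "c = 0 \<or> P (c - a)"
    then show "P c"
    proof
      assume "c = 0"
      then show ?thesis unfolding P_def by (intro exI[of _ 0]) simp
    next
      assume "P (c - a)"
      then obtain m where "\<forall>i. Poly_Mapping.lookup (c - a) i = int m * Poly_Mapping.lookup a i"
        unfolding P_def by blast
      then have "\<forall>i. Poly_Mapping.lookup c i = int (Suc m) * Poly_Mapping.lookup a i"
        by (simp add: lookup_minus algebra_simps)
      then show ?thesis unfolding P_def by blast
    qed
  qed
  moreover have "\<not> P (0 - a)"
  proof
    assume "P (0 - a)"
    then obtain m where "\<forall>i. Poly_Mapping.lookup (0 - a) i = int m * Poly_Mapping.lookup a i"
      unfolding P_def by blast
    then have "(1 + int m) * Poly_Mapping.lookup a i = 0" for i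
      by (simp add: lookup_minus distrib_right) (metis add.right_inverse)
    then have "a = 0" by (intro poly_mapping_eqI) (auto simp: add_eq_0_iff)
    with \<open>a \<noteq> 0\<close> show False ..
  qed
  moreover have "lcoeff ((1 - lmonom a) * geom_series a) c =
      (lcoeff (geom_series a) c - lcoeff (geom_series a) (c - a) :: 'a)"
    by (simp add: left_diff_distrib coeff_minus coeff_monom_times)
  ultimately show "lcoeff ((1 - lmonom a) * geom_series a) c = lcoeff (1 :: 'a laurent) c"
    unfolding g one_laurent_def lmonom.rep_eq by (cases "c = 0") simp_all
qed

lift_definition CT :: "nat \<Rightarrow> 'a::zero laurent \<Rightarrow> 'a laurent"
  is "\<lambda>i F a. if Poly_Mapping.lookup a i = 0 then F a else 0"
  by auto

text \<open>
  \<open>xpow i k\<close> is the exponent vector of \<open>x_i^k\<close>; that of \<open>x_i / x_j\<close> is \<open>xpow i 1 - xpow j 1\<close>.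
\<close>

abbreviation xpow :: "nat \<Rightarrow> int \<Rightarrow> expo" where
  "xpow \<equiv> Poly_Mapping.single"

lemma psum_xpow: "psum (xpow i k) j = (if i \<le> j then k else 0)"
  by (simp add: psum_def lookup_single when_def)

lemma geom_series_var:
  "(1 - lmonom (xpow i 1)) * geom_series (xpow i 1) = (1 :: 'a::comm_ring_1 laurent)"
proof (rule geom_series_inverse)
  show "0 \<le> psum (xpow i 1) k" for k by (simp add: psum_xpow)
  show "xpow i 1 \<noteq> 0" by (metis lookup_single_eq lookup_zero zero_neq_one)
qed

lemma geom_series_quotient:
  assumes "i < j"
  shows "(1 - lmonom (xpow i 1 - xpow j 1)) * geom_series (xpow i 1 - xpow j 1)
    = (1 :: 'a::comm_ring_1 laurent)"
proof (rule geom_series_inverse)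
  show "0 \<le> psum (xpow i 1 - xpow j 1) k" for k
    using assms by (simp add: psum_diff psum_xpow)
  have "psum (xpow i 1 - xpow j 1) i = 1"
    using assms by (simp add: psum_diff psum_xpow)
  then show "xpow i 1 - xpow j 1 \<noteq> 0" by (metis psum_0 zero_neq_one)
qed


section \<open>Normalized volume\<close>

definition integer_lattice :: "('e \<Rightarrow>\<^sub>0 real) set" where
  "integer_lattice = {f. \<forall>e. Poly_Mapping.lookup f e \<in> \<int>}"

definition affine_chart :: "nat \<Rightarrow> 'v::real_vector \<Rightarrow> (nat \<Rightarrow> 'v) \<Rightarrow> (nat \<Rightarrow> real) \<Rightarrow> 'v" where
  "affine_chart d p b x = p + (\<Sum>i<d. x i *\<^sub>R b i)"

text \<open>
  Coordinates on a \<open>d\<close>-dimensional affine subspace \<open>A\<close> under which the points of the lattice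
  \<open>L\<close> in \<open>A\<close> become the standard lattice.
\<close>

definition lattice_frame ::
    "'v::real_vector set \<Rightarrow> 'v set \<Rightarrow> nat \<Rightarrow> 'v \<Rightarrow> (nat \<Rightarrow> 'v) \<Rightarrow> bool" where
  "lattice_frame L A d p b \<longleftrightarrow>
     bij_betw (affine_chart d p b) ({..<d} \<rightarrow>\<^sub>E UNIV) A \<and>
     affine_chart d p b ` ({..<d} \<rightarrow>\<^sub>E \<int>) = A \<inter> L"

text \<open>
  Volume in lattice coordinates on the affine hull.  Two choices of coordinates differ by an
  affine unimodular map, so the value does not depend on the choice; the factor \<open>fact d\<close> gives
  a unimodular simplex volume 1.
\<close>

definition normalized_volume :: "'v::real_vector set \<Rightarrow> 'v set \<Rightarrow> real" where
  "normalized_volume L P = (THE v. \<exists>d p b. lattice_frame L (affine hull P) d p b \<and>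
     v = fact d * measure (Pi\<^sub>M {..<d} (\<lambda>_. lborel))
                   {x \<in> {..<d} \<rightarrow>\<^sub>E UNIV. affine_chart d p b x \<in> P})"


section \<open>Multigraphs and flow polytopes\<close>

text \<open>
  A loopless multigraph on a set of natural numbers is given by its multiset of edges \<open>(i, j)\<close>
  with \<open>i < j\<close>.  The parallel copies of \<open>e\<close> are distinguished by an index below \<open>count E e\<close>.
\<close>

type_synonym edges = "(nat \<times> nat) multiset"

definition edge_set :: "edges \<Rightarrow> ((nat \<times> nat) \<times> nat) set" where
  "edge_set E = {(e, k). k < count E e}"

definition out_total :: "edges \<Rightarrow> ((nat \<times> nat) \<times> nat \<Rightarrow>\<^sub>0 real) \<Rightarrow> nat \<Rightarrow> real" where
  "out_total E f v = (\<Sum>e | e \<in> edge_set E \<and> fst (fst e) = v. Poly_Mapping.lookup f e)"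

definition in_total :: "edges \<Rightarrow> ((nat \<times> nat) \<times> nat \<Rightarrow>\<^sub>0 real) \<Rightarrow> nat \<Rightarrow> real" where
  "in_total E f v = (\<Sum>e | e \<in> edge_set E \<and> snd (fst e) = v. Poly_Mapping.lookup f e)"

definition flow_polytope :: "nat set \<Rightarrow> edges \<Rightarrow> ((nat \<times> nat) \<times> nat \<Rightarrow>\<^sub>0 real) set" where
  "flow_polytope V E = {f. Poly_Mapping.keys f \<subseteq> edge_set E \<and>
     (\<forall>e\<in>edge_set E. 0 \<le> Poly_Mapping.lookup f e) \<and>
     out_total E f (Min V) = 1 \<and>
     in_total E f (Max V) = 1 \<and>
     (\<forall>v\<in>V - {Min V, Max V}. in_total E f v = out_total E f v)}"

definition multigraph_on :: "nat set \<Rightarrow> edges \<Rightarrow> bool" where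
  "multigraph_on V E \<longleftrightarrow> (\<forall>(i, j)\<in>#E. i \<in> V \<and> j \<in> V \<and> i < j)"

definition restrict_edges :: "edges \<Rightarrow> nat set \<Rightarrow> edges" where
  "restrict_edges E V = filter_mset (\<lambda>(i, j). i \<in> V \<and> j \<in> V) E"

text \<open>
  For a graph on \<open>{1..n + 1}\<close> the added source and sink are the vertices 0 and \<open>n + 2\<close>, so the
  extended graph lives on \<open>{0..n + 2}\<close>.
\<close>

definition extended_graph :: "nat \<Rightarrow> edges \<Rightarrow> edges" where
  "extended_graph n E = E + mset_set ((\<lambda>i. (0, i)) ` {1..n + 1} \<union> (\<lambda>i. (i, n + 2)) ` {1..n + 1})"

definition edge_increment :: "edges \<Rightarrow> nat \<Rightarrow> int" where
  "edge_increment E i = int (size (restrict_edges E {1..i + 1})) - int (size (restrict_edges E {1..i}))"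

end

theory Submission
  imports Defs
begin

text \<open>
  Write \<open>N = n + 1\<close> and let \<open>s\<close>, \<open>t\<close> be the added source and sink.  A flow of the extended graph is
  determined by its values on the free edges, namely the edges of \<open>G\<close> and the edges \<open>(i, t)\<close> with
  \<open>i \<le> n\<close>: the conservation laws give the value on each \<open>(s, l)\<close>, and the normalization at \<open>t\<close> gives
  the value on \<open>(N, t)\<close>.  Every integral choice on the free edges extends to an integral flow, so the
  free edges are lattice coordinates on the affine hull (\<open>lattice_frame_flow_chart\<close>).  When \<open>t\<close> is
  merged with \<open>N\<close>, the free edges become \<open>d\<close> edges \<open>(u, v)\<close> with \<open>u < v \<le> N\<close>, and nonnegativity of
  the flow says that the coordinates \<open>x\<close> are nonnegative and \<open>inflow l \<le> b l + outflow l\<close> at every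
  vertex \<open>l\<close>, where \<open>b\<close> is the unit vector at \<open>N\<close>.

  The volume of this region is found for all \<open>b \<ge> 0\<close> at once, by adding the edges in the order of
  their final vertices.  If the last edge \<open>(u, v)\<close> carries \<open>y\<close>, the remaining coordinates range over
  the region of the remaining edges for the vector \<open>b\<close> with \<open>b u\<close> raised and \<open>b v\<close> lowered by
  \<open>y\<close>, and \<open>y\<close> is subject to \<open>0 \<le> y \<le> b v\<close>, because no earlier edge leaves \<open>v\<close>.  Integration over
  \<open>y\<close> maps divided powers to sums of divided powers:

  \<open>b_u^p / p! * b_v^q / q!  \<mapsto>  \<Sum>i\<le>p. b_u^(p - i) / (p - i)! * b_v^(q + i + 1) / (q + i + 1)!\<close>

  Hence the volume is a sum of products of divided powers of total degree \<open>d\<close>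
  (\<open>emeasure_flow_region\<close>).  At the unit vector each product vanishes except \<open>b_N^d / d!\<close>,
  whose value is \<open>1 / d!\<close>, so the normalized volume is the number of times that \<open>b_N^d / d!\<close> occurs.

  Adding an edge changes the multiplicities of the exponent vectors \<open>j\<close> in the same way as
  multiplication by \<open>1 / (1 - x_u / x_v)\<close>, with \<open>x_N = 1\<close>, changes the coefficients of a series: the
  multiplicity of \<open>j\<close> is the coefficient at the exponent vector with entries \<open>indegree l - j l\<close>
  (\<open>count_monomials_eq_coeff\<close>).  For \<open>b_N^d\<close> this is the coefficient of \<open>\<Prod>l\<le>n. x_l^(indegree l)\<close>,
  and \<open>c_(i-1)\<close> is the indegree of \<open>i\<close> in \<open>G\<close>, which gives the constant term.

  Normalized volume is defined through an arbitrary choice of lattice coordinates, so it also has to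
  be shown that the choice is immaterial (\<open>normalized_volume_eq\<close>).  This needs that an affine
  isomorphism of coordinate spaces that matches their integer points preserves Lebesgue measure
  (\<open>emeasure_vimage_lattice_isomorphism\<close>); Fubini's theorem, translation invariance and the
  fact that all fundamental domains of the integer lattice have volume 1 suffice for that.
\<close>


section \<open>Lattice isomorphisms preserve Lebesgue measure\<close>

abbreviation coord_measure :: "nat \<Rightarrow> (nat \<Rightarrow> real) measure" where
  "coord_measure d \<equiv> Pi\<^sub>M {..<d} (\<lambda>_. lborel)"

abbreviation coord_lattice :: "nat \<Rightarrow> (nat \<Rightarrow> real) set" where
  "coord_lattice d \<equiv> {..<d} \<rightarrow>\<^sub>E \<int>"

definition vadd :: "nat \<Rightarrow> (nat \<Rightarrow> real) \<Rightarrow> (nat \<Rightarrow> real) \<Rightarrow> (nat \<Rightarrow> real)" where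
  "vadd d x y = (\<lambda>i\<in>{..<d}. x i + y i)"

definition vneg :: "nat \<Rightarrow> (nat \<Rightarrow> real) \<Rightarrow> (nat \<Rightarrow> real)" where
  "vneg d x = (\<lambda>i\<in>{..<d}. - x i)"

definition unit_cube :: "nat \<Rightarrow> (nat \<Rightarrow> real) set" where
  "unit_cube d = {..<d} \<rightarrow>\<^sub>E {0..<1}"

lemma space_coord_measure: "space (coord_measure d) = {..<d} \<rightarrow>\<^sub>E UNIV"
  by (simp add: space_PiM)

lemma vadd_in_space [simp]: "vadd d x y \<in> {..<d} \<rightarrow>\<^sub>E UNIV"
  by (auto simp: vadd_def)

lemma coord_borel_measurable:
  "i < d \<Longrightarrow> (\<lambda>x. x i) \<in> borel_measurable (coord_measure d)"
  using measurable_component_singleton[of i "{..<d}" "\<lambda>_. lborel :: real measure"] by simp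

lemma measurable_into_coord_measure:
  assumes "\<And>i. i < d \<Longrightarrow> (\<lambda>w. f w i) \<in> borel_measurable N"
  shows "(\<lambda>w. \<lambda>i\<in>{..<d}. f w i) \<in> measurable N (coord_measure d)"
  using assms by (intro measurable_restrict) auto

lemma sigma_finite_coord_measure: "sigma_finite_measure (coord_measure d)"
proof -
  interpret product_sigma_finite "\<lambda>_ :: nat. lborel :: real measure" by standard
  show ?thesis by (rule sigma_finite) simp
qed

lemma emeasure_coord_box:
  "(\<And>i. i < d \<Longrightarrow> A i \<in> sets borel) \<Longrightarrow>
    emeasure (coord_measure d) (Pi\<^sub>E {..<d} A) = (\<Prod>i<d. emeasure lborel (A i))"
proof -
  interpret product_sigma_finite "\<lambda>_ :: nat. lborel :: real measure" by standard
  show "(\<And>i. i < d \<Longrightarrow> A i \<in> sets borel) \<Longrightarrow>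
    emeasure (coord_measure d) (Pi\<^sub>E {..<d} A) = (\<Prod>i<d. emeasure lborel (A i))"
    by (subst emeasure_PiM) auto
qed

lemma unit_cube_sets [measurable]: "unit_cube d \<in> sets (coord_measure d)"
  unfolding unit_cube_def by (rule sets_PiM_I_finite) auto

lemma emeasure_unit_cube: "emeasure (coord_measure d) (unit_cube d) = 1"
  unfolding unit_cube_def by (subst emeasure_coord_box) auto

text \<open>
  Boxes generate the product sets, and a translate of a box is a box of the same volume.
\<close>

lemma distr_coord_measure_translate:
  "distr (coord_measure d) (coord_measure d) (\<lambda>x. vadd d x t) = coord_measure d"
proof -
  interpret product_sigma_finite "\<lambda>_ :: nat. lborel :: real measure" by standard
  have meas: "(\<lambda>x. vadd d x t) \<in> measurable (coord_measure d) (coord_measure d)"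
    unfolding vadd_def
    by (intro measurable_into_coord_measure borel_measurable_add coord_borel_measurable) auto
  show ?thesis
  proof (rule PiM_eqI)
    fix A :: "nat \<Rightarrow> real set"
    assume A: "\<And>i. i \<in> {..<d} \<Longrightarrow> A i \<in> sets lborel"
    have pre: "(+) (t i) -` A i \<in> sets borel" if "i < d" for i
      using measurable_sets[of "(+) (t i)" borel borel "A i"] A that by simp
    have "emeasure (distr (coord_measure d) (coord_measure d) (\<lambda>x. vadd d x t)) (Pi\<^sub>E {..<d} A) =
        emeasure (coord_measure d) ((\<lambda>x. vadd d x t) -` Pi\<^sub>E {..<d} A \<inter> space (coord_measure d))"
      using A by (intro emeasure_distr meas sets_PiM_I_finite) auto
    also have "(\<lambda>x. vadd d x t) -` Pi\<^sub>E {..<d} A \<inter> space (coord_measure d) =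
        Pi\<^sub>E {..<d} (\<lambda>i. (+) (t i) -` A i)"
      by (auto simp: vadd_def space_PiM PiE_iff add.commute)
    also have "emeasure (coord_measure d) \<dots> = (\<Prod>i<d. emeasure lborel ((+) (t i) -` A i))"
      using pre by (rule emeasure_coord_box)
    also have "\<dots> = (\<Prod>i<d. emeasure lborel (A i))"
    proof (rule prod.cong[OF refl])
      fix i assume "i \<in> {..<d}"
      then have "A i \<in> sets borel" using A[of i] by simp
      then have "emeasure (distr lborel borel ((+) (t i))) (A i) = emeasure lborel ((+) (t i) -` A i)"
        by (subst emeasure_distr) auto
      then show "emeasure lborel ((+) (t i) -` A i) = emeasure lborel (A i)"
        by (simp only: lborel_distr_plus)
    qed
    finally show "emeasure (distr (coord_measure d) (coord_measure d) (\<lambda>x. vadd d x t)) (Pi\<^sub>E {..<d} A)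
        = (\<Prod>i<d. emeasure lborel (A i))" .
  qed auto
qed

lemma nn_integral_translate:
  assumes f: "f \<in> borel_measurable (coord_measure d)"
  shows "(\<integral>\<^sup>+ x. f (vadd d x t) \<partial>coord_measure d) = (\<integral>\<^sup>+ x. f x \<partial>coord_measure d)"
proof -
  have meas: "(\<lambda>x. vadd d x t) \<in> measurable (coord_measure d) (coord_measure d)"
    unfolding vadd_def
    by (intro measurable_into_coord_measure borel_measurable_add coord_borel_measurable) auto
  have "(\<integral>\<^sup>+ x. f (vadd d x t) \<partial>coord_measure d) =
      (\<integral>\<^sup>+ x. f x \<partial>distr (coord_measure d) (coord_measure d) (\<lambda>x. vadd d x t))"
    by (rule nn_integral_distr[OF meas, symmetric]) (use f in simp)
  then show ?thesis by (simp add: distr_coord_measure_translate)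
qed

lemma nn_integral_count_space_unique:
  assumes "\<exists>!z. z \<in> Z \<and> Q z"
  shows "(\<integral>\<^sup>+ z. indicator {z. Q z} z \<partial>count_space Z) = 1"
proof -
  obtain z0 where z0: "z0 \<in> Z" "Q z0" "\<And>z. z \<in> Z \<Longrightarrow> Q z \<Longrightarrow> z = z0"
    using assms by blast
  have "(\<integral>\<^sup>+ z. indicator {z. Q z} z \<partial>count_space Z) = (\<integral>\<^sup>+ z. indicator {z0} z \<partial>count_space Z)"
  proof (rule nn_integral_cong)
    fix z assume "z \<in> space (count_space Z)"
    then have "Q z \<longleftrightarrow> z = z0" using z0 by (metis space_count_space)
    then show "(indicator {z. Q z} z :: ennreal) = indicator {z0} z" by (simp add: indicator_def)
  qed
  also have "\<dots> = emeasure (count_space Z) {z0}"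
    by (rule nn_integral_indicator) (simp add: z0(1))
  also have "\<dots> = 1"
    using z0(1) by (simp add: emeasure_count_space_finite)
  finally show ?thesis .
qed

lemma countable_coord_lattice: "countable (coord_lattice d)"
  by (rule countable_PiE) (simp_all add: Ints_def)

lemma vneg_in_coord_lattice: "z \<in> coord_lattice d \<Longrightarrow> vneg d z \<in> coord_lattice d"
  unfolding vneg_def by (rule restrict_PiE_iff[THEN iffD2]) (blast intro: Ints_minus dest: PiE_mem)

text \<open>
  The integer vector is minus the coordinatewise floor of \<open>x\<close>.
\<close>

lemma unit_cube_lattice_translate:
  "\<exists>!z. z \<in> coord_lattice d \<and> vadd d x z \<in> unit_cube d"
proof (rule ex1I)
  let ?z = "\<lambda>i\<in>{..<d}. - of_int \<lfloor>x i\<rfloor> :: real"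
  show "?z \<in> coord_lattice d \<and> vadd d x ?z \<in> unit_cube d"
  proof (intro conjI)
    show "vadd d x ?z \<in> unit_cube d"
      unfolding vadd_def unit_cube_def
    proof (rule restrict_PiE_iff[THEN iffD2], rule ballI)
      fix i assume "i \<in> {..<d}"
      then show "x i + ?z i \<in> {0..<1}"
        using of_int_floor_le[of "x i"] real_of_int_floor_add_one_gt[of "x i"] by simp linarith
    qed
  qed auto
  fix z assume z: "z \<in> coord_lattice d \<and> vadd d x z \<in> unit_cube d"
  show "z = ?z"
  proof (rule PiE_ext[of _ "{..<d}" "\<lambda>_. \<int>"])
    fix i assume i: "i \<in> {..<d}"
    then obtain k where k: "z i = of_int k" using z by (auto elim!: Ints_cases dest!: PiE_mem)
    have "0 \<le> x i + z i \<and> x i + z i < 1"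
      using z i by (auto simp: unit_cube_def vadd_def PiE_iff)
    then have "\<lfloor>x i\<rfloor> = - k" unfolding k by (intro floor_unique) auto
    then show "z i = ?z i" using i k by simp
  qed (use z in auto)
qed

text \<open>
  Every fundamental domain \<open>D\<close> of the integer lattice has the volume of the unit cube \<open>C\<close>: both are
  the sum over the lattice vectors \<open>z\<close> of the volume of \<open>D \<inter> (C - z)\<close>, which translation turns into
  the volume of \<open>(D + z) \<inter> C\<close>.
\<close>

lemma emeasure_fundamental_domain:
  assumes D: "D \<in> sets (coord_measure d)"
    and dom: "\<And>x. x \<in> {..<d} \<rightarrow>\<^sub>E UNIV \<Longrightarrow> \<exists>!z. z \<in> coord_lattice d \<and> vadd d x z \<in> D"
  shows "emeasure (coord_measure d) D = 1"
proof -
  let ?\<mu> = "coord_measure d" and ?Z = "coord_lattice d" and ?C = "unit_cube d"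
  have transl: "(\<lambda>x. vadd d x z) \<in> measurable ?\<mu> ?\<mu>" for z
    unfolding vadd_def
    by (intro measurable_into_coord_measure borel_measurable_add coord_borel_measurable) auto
  have transl_ind: "(\<lambda>x. indicator A (vadd d x z) :: ennreal) \<in> borel_measurable ?\<mu>"
    if "A \<in> sets ?\<mu>" for A z
    using measurable_compose[OF transl borel_measurable_indicator[OF that]] .
  have meas1: "(\<lambda>x. indicator D x * indicator ?C (vadd d x z) :: ennreal) \<in> borel_measurable ?\<mu>" for z
    by (intro borel_measurable_times_ennreal borel_measurable_indicator[OF D] transl_ind[OF unit_cube_sets])
  have meas2: "(\<lambda>x. indicator D (vadd d x t) * indicator ?C x :: ennreal) \<in> borel_measurable ?\<mu>" for t
    by (intro borel_measurable_times_ennreal borel_measurable_indicator[OF unit_cube_sets] transl_ind[OF D])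
  have sumC: "(\<integral>\<^sup>+ z. indicator ?C (vadd d x z) \<partial>count_space ?Z) = 1" for x
    using nn_integral_count_space_unique[OF unit_cube_lattice_translate[of d x]]
    by (simp add: indicator_def)
  have sumD: "(\<integral>\<^sup>+ z. indicator D (vadd d x (vneg d z)) \<partial>count_space ?Z) = 1"
    if x: "x \<in> space ?\<mu>" for x
  proof -
    obtain z0 where z0: "z0 \<in> ?Z \<and> vadd d x z0 \<in> D"
        and uniq: "\<forall>z. z \<in> ?Z \<and> vadd d x z \<in> D \<longrightarrow> z = z0"
      using dom[of x, OF x[unfolded space_coord_measure]] by (rule ex1E)
    have invol: "vneg d (vneg d z) = z" if "z \<in> ?Z" for z
      using that by (auto simp: vneg_def fun_eq_iff PiE_def extensional_def)
    have "\<exists>!z. z \<in> ?Z \<and> vadd d x (vneg d z) \<in> D"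
    proof (rule ex1I)
      show "vneg d z0 \<in> ?Z \<and> vadd d x (vneg d (vneg d z0)) \<in> D"
        using z0 invol vneg_in_coord_lattice by simp
      fix z assume z: "z \<in> ?Z \<and> vadd d x (vneg d z) \<in> D"
      then have "vneg d z = z0" using uniq vneg_in_coord_lattice by blast
      then show "z = vneg d z0" using invol z by metis
    qed
    from nn_integral_count_space_unique[OF this] show ?thesis by (simp add: indicator_def)
  qed
  have "emeasure ?\<mu> D = (\<integral>\<^sup>+ x. indicator D x \<partial>?\<mu>)"
    using D by simp
  also have "\<dots> = (\<integral>\<^sup>+ x. (\<integral>\<^sup>+ z. indicator D x * indicator ?C (vadd d x z) \<partial>count_space ?Z) \<partial>?\<mu>)"
    by (simp add: nn_integral_cmult sumC)
  also have "\<dots> = (\<integral>\<^sup>+ z. (\<integral>\<^sup>+ x. indicator D x * indicator ?C (vadd d x z) \<partial>?\<mu>) \<partial>count_space ?Z)"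
    by (rule nn_integral_count_space_nn_integral[OF countable_coord_lattice meas1])
  also have "\<dots> = (\<integral>\<^sup>+ z. (\<integral>\<^sup>+ x. indicator D (vadd d x (vneg d z)) * indicator ?C x \<partial>?\<mu>) \<partial>count_space ?Z)"
  proof (rule nn_integral_cong)
    fix z
    have "(\<integral>\<^sup>+ x. indicator D x * indicator ?C (vadd d x z) \<partial>?\<mu>) =
        (\<integral>\<^sup>+ x. indicator D (vadd d x (vneg d z)) * indicator ?C (vadd d (vadd d x (vneg d z)) z) \<partial>?\<mu>)"
      by (rule nn_integral_translate[OF meas1, symmetric])
    also have "\<dots> = (\<integral>\<^sup>+ x. indicator D (vadd d x (vneg d z)) * indicator ?C x \<partial>?\<mu>)"
    proof (rule nn_integral_cong)
      fix x assume "x \<in> space ?\<mu>"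
      then have "vadd d (vadd d x (vneg d z)) z = x"
        by (auto simp: vadd_def vneg_def space_PiM fun_eq_iff PiE_def extensional_def)
      then show "indicator D (vadd d x (vneg d z)) * indicator ?C (vadd d (vadd d x (vneg d z)) z) =
          (indicator D (vadd d x (vneg d z)) * indicator ?C x :: ennreal)" by simp
    qed
    finally show "(\<integral>\<^sup>+ x. indicator D x * indicator ?C (vadd d x z) \<partial>?\<mu>) =
      (\<integral>\<^sup>+ x. indicator D (vadd d x (vneg d z)) * indicator ?C x \<partial>?\<mu>)" .
  qed
  also have "\<dots> = (\<integral>\<^sup>+ x. (\<integral>\<^sup>+ z. indicator D (vadd d x (vneg d z)) * indicator ?C x \<partial>count_space ?Z) \<partial>?\<mu>)"
    by (rule nn_integral_count_space_nn_integral[OF countable_coord_lattice meas2, symmetric])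
  also have "\<dots> = (\<integral>\<^sup>+ x. indicator ?C x \<partial>?\<mu>)"
    by (rule nn_integral_cong) (simp add: nn_integral_multc sumD)
  also have "\<dots> = 1"
    using unit_cube_sets by (simp add: emeasure_unit_cube)
  finally show ?thesis .
qed

definition affine_coords :: "nat \<Rightarrow> nat \<Rightarrow> (nat \<Rightarrow> nat \<Rightarrow> real) \<Rightarrow> (nat \<Rightarrow> real) \<Rightarrow> (nat \<Rightarrow> real) \<Rightarrow> (nat \<Rightarrow> real)"
  where "affine_coords d e M q x = (\<lambda>i\<in>{..<e}. q i + (\<Sum>j<d. M i j * x j))"

lemma affine_coords_measurable:
  "affine_coords d e M q \<in> measurable (coord_measure d) (coord_measure e)"
  unfolding affine_coords_def[abs_def]
  by (intro measurable_into_coord_measure borel_measurable_add borel_measurable_sum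
      borel_measurable_times coord_borel_measurable) auto

lemma affine_coords_vadd:
  "affine_coords d e M q (vadd d w t) = vadd e (affine_coords d e M q w) (affine_coords d e M (\<lambda>_. 0) t)"
  by (auto simp: affine_coords_def vadd_def fun_eq_iff sum.distrib distrib_left)

lemma affine_coords_linear_part:
  "affine_coords d e M q w = vadd e q (affine_coords d e M (\<lambda>_. 0) w)"
  by (auto simp: affine_coords_def vadd_def fun_eq_iff)

text \<open>
  Let \<open>C\<close> be the unit cube and consider the double integral over \<open>w\<close> and \<open>x\<close> of \<open>C x * S (\<phi> w + x)\<close>,
  sets standing for their indicator functions.  For fixed \<open>x\<close> the shift by \<open>x\<close> comes from a translation
  of \<open>w\<close>, as \<open>\<phi>\<close> is affine and onto, so the integral is the volume of \<open>C\<close> times that of the preimage of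
  \<open>S\<close>.  For fixed \<open>w\<close> the substitution \<open>x - \<phi> w\<close> for \<open>x\<close> gives \<open>C (x - \<phi> w) * S x\<close>, and the \<open>w\<close> with
  \<open>x - \<phi> w \<in> C\<close> form a fundamental domain, as the linear part of \<open>\<phi>\<close> maps lattice onto lattice; so the
  integral is also the volume of \<open>S\<close>.
\<close>

theorem emeasure_vimage_lattice_isomorphism:
  fixes d e :: nat and M q
  defines "\<phi> \<equiv> affine_coords d e M q"
  assumes bij: "bij_betw \<phi> ({..<d} \<rightarrow>\<^sub>E UNIV) ({..<e} \<rightarrow>\<^sub>E UNIV)"
    and lattice: "\<phi> ` coord_lattice d = coord_lattice e"
    and S: "S \<in> sets (coord_measure e)"
  shows "emeasure (coord_measure d) (\<phi> -` S \<inter> space (coord_measure d)) = emeasure (coord_measure e) S"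
proof -
  let ?\<mu> = "coord_measure d" and ?\<nu> = "coord_measure e" and ?C = "unit_cube e"
  define L where "L = affine_coords d e M (\<lambda>_. 0)"
  have \<phi>_vadd: "\<phi> (vadd d w t) = vadd e (\<phi> w) (L t)" for w t
    unfolding \<phi>_def L_def by (rule affine_coords_vadd)
  have \<phi>_meas: "\<phi> \<in> measurable ?\<mu> ?\<nu>"
    unfolding \<phi>_def by (rule affine_coords_measurable)
  have \<phi>_L: "\<phi> w = vadd e q (L w)" for w
    unfolding \<phi>_def L_def by (rule affine_coords_linear_part)
  have L_space: "L w \<in> {..<e} \<rightarrow>\<^sub>E UNIV" for w
    unfolding L_def affine_coords_def by (rule restrict_PiE_iff[THEN iffD2]) simp
  have cancel: "a = b" if "vadd e q a = vadd e q b" "a \<in> {..<e} \<rightarrow>\<^sub>E UNIV" "b \<in> {..<e} \<rightarrow>\<^sub>E UNIV" for a b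
  proof (rule PiE_ext[OF that(2,3)])
    fix i assume "i \<in> {..<e}"
    then show "a i = b i" using fun_cong[OF that(1), of i] by (simp add: vadd_def)
  qed
  have L_inj: "inj_on L ({..<d} \<rightarrow>\<^sub>E UNIV)"
  proof (rule inj_onI)
    fix a b :: "nat \<Rightarrow> real"
    assume ab: "a \<in> {..<d} \<rightarrow>\<^sub>E UNIV" "b \<in> {..<d} \<rightarrow>\<^sub>E UNIV" "L a = L b"
    have "\<phi> a = \<phi> b" by (simp only: \<phi>_L ab(3))
    then show "a = b" by (rule inj_onD[OF bij_betw_imp_inj_on[OF bij] _ ab(1,2)])
  qed
  have L_surj: "\<exists>t\<in>{..<d} \<rightarrow>\<^sub>E UNIV. L t = x" if "x \<in> {..<e} \<rightarrow>\<^sub>E UNIV" for x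
  proof -
    have "vadd e q x \<in> \<phi> ` ({..<d} \<rightarrow>\<^sub>E UNIV)"
      by (simp only: bij_betw_imp_surj_on[OF bij] vadd_in_space)
    then obtain t where t: "vadd e q x = \<phi> t" "t \<in> {..<d} \<rightarrow>\<^sub>E UNIV" by (rule imageE)
    have "L t = x" using t(1) by (intro cancel[OF _ L_space that]) (simp only: \<phi>_L)
    with t(2) show ?thesis by blast
  qed
  have q_int: "q i \<in> \<int>" if "i < e" for i
  proof -
    have "(\<lambda>i\<in>{..<d}. 0 :: real) \<in> coord_lattice d"
      by (rule restrict_PiE_iff[THEN iffD2]) simp
    from imageI[OF this, of \<phi>] have "\<phi> (\<lambda>i\<in>{..<d}. 0) \<in> coord_lattice e"
      by (simp only: lattice)
    moreover have "\<phi> (\<lambda>i\<in>{..<d}. 0) i = q i" using that by (auto simp: \<phi>_def affine_coords_def)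
    ultimately show ?thesis using that by (metis (no_types, lifting) PiE_mem lessThan_iff)
  qed
  have L_int: "L z \<in> coord_lattice e" if "z \<in> coord_lattice d" for z
  proof -
    have "\<phi> z \<in> coord_lattice e" using imageI[OF that, of \<phi>] by (simp only: lattice)
    then have "\<phi> z i - q i \<in> \<int>" if "i < e" for i
      using q_int[OF that] PiE_mem[of "\<phi> z" "{..<e}" "\<lambda>_. \<int>" i] that by (intro Ints_diff) auto
    moreover have "\<phi> z i - q i = L z i" if "i < e" for i
      using that by (simp add: \<phi>_L vadd_def)
    ultimately have "L z i \<in> \<int>" if "i < e" for i using that by simp
    then show ?thesis using L_space[of z] unfolding PiE_iff by blast
  qed
  have L_int_surj: "\<exists>z\<in>coord_lattice d. L z = k" if "k \<in> coord_lattice e" for k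
  proof -
    have "vadd e q k \<in> coord_lattice e"
      unfolding vadd_def using q_int PiE_mem[OF that]
      by (intro restrict_PiE_iff[THEN iffD2] ballI Ints_add) auto
    then have "vadd e q k \<in> \<phi> ` coord_lattice d" by (simp only: lattice)
    then obtain z where z: "vadd e q k = \<phi> z" "z \<in> coord_lattice d" by (rule imageE)
    have k: "k \<in> {..<e} \<rightarrow>\<^sub>E UNIV" using that unfolding PiE_iff by blast
    have "L z = k" using z(1) by (intro cancel[OF _ L_space k]) (simp only: \<phi>_L)
    with z(2) show ?thesis by blast
  qed
  note ind = measurable_compose[OF _ borel_measurable_indicator]
  have \<phi>_coord: "(\<lambda>w. \<phi> w i) \<in> borel_measurable ?\<mu>" if "i < e" for i
    using measurable_compose[OF \<phi>_meas coord_borel_measurable[OF that]] .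
  \<comment> \<open>The \<open>w\<close> with \<open>x - \<phi> w\<close> in the cube form a fundamental domain.\<close>
  have fiber: "(\<integral>\<^sup>+ w. indicator ?C (vadd e x (vneg e (\<phi> w))) \<partial>?\<mu>) = 1" for x
  proof -
    define D where "D = {w \<in> space ?\<mu>. vadd e x (vneg e (\<phi> w)) \<in> ?C}"
    have meas: "(\<lambda>w. vadd e x (vneg e (\<phi> w))) \<in> measurable ?\<mu> ?\<nu>"
      unfolding vadd_def
    proof (intro measurable_into_coord_measure borel_measurable_add)
      show "(\<lambda>w. vneg e (\<phi> w) i) \<in> borel_measurable ?\<mu>" if "i < e" for i
        using that \<phi>_coord by (simp add: vneg_def)
    qed auto
    have D: "D \<in> sets ?\<mu>"
      using measurable_sets[OF meas unit_cube_sets] by (simp add: D_def vimage_def Int_def conj_commute)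
    have "emeasure ?\<mu> D = 1"
    proof (rule emeasure_fundamental_domain[OF D])
      fix w :: "nat \<Rightarrow> real" assume w: "w \<in> {..<d} \<rightarrow>\<^sub>E UNIV"
      define y where "y = vadd e x (vneg e (\<phi> w))"
      have D_iff: "vadd d w z \<in> D \<longleftrightarrow> vadd e y (vneg e (L z)) \<in> ?C" for z
      proof -
        have "vadd e x (vneg e (\<phi> (vadd d w z))) = vadd e y (vneg e (L z))"
          unfolding y_def \<phi>_vadd by (simp add: vadd_def vneg_def fun_eq_iff)
        then show ?thesis by (simp add: D_def space_PiM)
      qed
      obtain k where k: "k \<in> coord_lattice e \<and> vadd e y k \<in> ?C"
          and uniq: "\<forall>k'. k' \<in> coord_lattice e \<and> vadd e y k' \<in> ?C \<longrightarrow> k' = k"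
        using unit_cube_lattice_translate[of e y] by (rule ex1E)
      have invol: "vneg e (vneg e a) = a" if "a \<in> {..<e} \<rightarrow>\<^sub>E UNIV" for a
        using that by (auto simp: vneg_def fun_eq_iff PiE_def extensional_def)
      have k_space: "k \<in> {..<e} \<rightarrow>\<^sub>E UNIV" using k by auto
      obtain z where z: "z \<in> coord_lattice d" "L z = vneg e k"
        using L_int_surj[OF vneg_in_coord_lattice[OF conjunct1[OF k]]] by blast
      show "\<exists>!z. z \<in> coord_lattice d \<and> vadd d w z \<in> D"
      proof (rule ex1I)
        show "z \<in> coord_lattice d \<and> vadd d w z \<in> D"
          using z k invol[OF k_space] by (simp add: D_iff)
        fix z' assume z': "z' \<in> coord_lattice d \<and> vadd d w z' \<in> D"
        then have "vneg e (L z') = k"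
          using uniq vneg_in_coord_lattice[OF L_int] D_iff by blast
        then have "L z' = L z" using z(2) invol[OF L_space] by metis
        moreover have "z' \<in> {..<d} \<rightarrow>\<^sub>E UNIV" "z \<in> {..<d} \<rightarrow>\<^sub>E UNIV" using z z' by auto
        ultimately show "z' = z" using L_inj by (auto dest: inj_onD)
      qed
    qed
    moreover have "(\<integral>\<^sup>+ w. indicator ?C (vadd e x (vneg e (\<phi> w))) \<partial>?\<mu>) = (\<integral>\<^sup>+ w. indicator D w \<partial>?\<mu>)"
      by (intro nn_integral_cong) (auto simp: D_def indicator_def)
    ultimately show ?thesis using D by simp
  qed
  have shift: "(\<integral>\<^sup>+ w. indicator S (\<phi> w) \<partial>?\<mu>) = (\<integral>\<^sup>+ w. indicator S (vadd e (\<phi> w) x) \<partial>?\<mu>)"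
    if x: "x \<in> space ?\<nu>" for x
  proof -
    obtain t where "L t = x" using L_surj[of x] x by (auto simp: space_PiM)
    then show ?thesis
      using nn_integral_translate[OF ind[OF \<phi>_meas S], of t] by (simp add: \<phi>_vadd)
  qed
  interpret P: pair_sigma_finite ?\<mu> ?\<nu>
    by (intro pair_sigma_finite.intro sigma_finite_coord_measure)
  have add_meas: "(\<lambda>p. vadd e (\<phi> (fst p)) (snd p)) \<in> measurable (?\<mu> \<Otimes>\<^sub>M ?\<nu>) ?\<nu>"
    unfolding vadd_def
    by (intro measurable_into_coord_measure borel_measurable_add measurable_compose[OF measurable_fst \<phi>_coord]
        measurable_compose[OF measurable_snd coord_borel_measurable])
  have diff_meas: "(\<lambda>p. vadd e (snd p) (vneg e (\<phi> (fst p)))) \<in> measurable (?\<mu> \<Otimes>\<^sub>M ?\<nu>) ?\<nu>"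
    unfolding vadd_def
  proof (intro measurable_into_coord_measure borel_measurable_add
        measurable_compose[OF measurable_snd coord_borel_measurable])
    show "(\<lambda>p. vneg e (\<phi> (fst p)) i) \<in> borel_measurable (?\<mu> \<Otimes>\<^sub>M ?\<nu>)" if "i < e" for i
      using measurable_compose[OF measurable_fst \<phi>_coord[OF that]] that by (simp add: vneg_def)
  qed
  have addx_meas: "(\<lambda>x. vadd e a x) \<in> measurable ?\<nu> ?\<nu>" for a
    unfolding vadd_def
    by (intro measurable_into_coord_measure borel_measurable_add coord_borel_measurable) auto
  have "emeasure ?\<mu> (\<phi> -` S \<inter> space ?\<mu>) = (\<integral>\<^sup>+ w. indicator (\<phi> -` S \<inter> space ?\<mu>) w \<partial>?\<mu>)"
    using measurable_sets[OF \<phi>_meas S] by simp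
  also have "\<dots> = (\<integral>\<^sup>+ w. indicator S (\<phi> w) \<partial>?\<mu>)"
    by (intro nn_integral_cong) (auto simp: indicator_def)
  also have "\<dots> = (\<integral>\<^sup>+ x. indicator ?C x * (\<integral>\<^sup>+ w. indicator S (\<phi> w) \<partial>?\<mu>) \<partial>?\<nu>)"
    by (simp add: nn_integral_multc emeasure_unit_cube)
  also have "\<dots> = (\<integral>\<^sup>+ x. (\<integral>\<^sup>+ w. indicator ?C x * indicator S (vadd e (\<phi> w) x) \<partial>?\<mu>) \<partial>?\<nu>)"
  proof (rule nn_integral_cong)
    fix x assume x: "x \<in> space ?\<nu>"
    have "(\<lambda>w. vadd e (\<phi> w) x) \<in> measurable ?\<mu> ?\<nu>"
      unfolding vadd_def by (intro measurable_into_coord_measure borel_measurable_add \<phi>_coord) auto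
    then show "indicator ?C x * (\<integral>\<^sup>+ w. indicator S (\<phi> w) \<partial>?\<mu>) =
        (\<integral>\<^sup>+ w. indicator ?C x * indicator S (vadd e (\<phi> w) x) \<partial>?\<mu>)"
      unfolding shift[OF x] by (intro nn_integral_cmult[symmetric] ind[OF _ S])
  qed
  also have "\<dots> = (\<integral>\<^sup>+ w. (\<integral>\<^sup>+ x. indicator ?C x * indicator S (vadd e (\<phi> w) x) \<partial>?\<nu>) \<partial>?\<mu>)"
    by (rule P.Fubini')
      (unfold case_prod_beta, intro borel_measurable_times_ennreal ind[OF add_meas S]
        ind[OF measurable_snd unit_cube_sets])
  also have "\<dots> = (\<integral>\<^sup>+ w. (\<integral>\<^sup>+ x. indicator ?C (vadd e x (vneg e (\<phi> w))) * indicator S x \<partial>?\<nu>) \<partial>?\<mu>)"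
  proof (rule nn_integral_cong)
    fix w
    have meas: "(\<lambda>x. indicator ?C x * indicator S (vadd e (\<phi> w) x) :: ennreal) \<in> borel_measurable ?\<nu>"
      by (intro borel_measurable_times_ennreal borel_measurable_indicator[OF unit_cube_sets]
          ind[OF addx_meas S])
    have "(\<integral>\<^sup>+ x. indicator ?C x * indicator S (vadd e (\<phi> w) x) \<partial>?\<nu>) =
        (\<integral>\<^sup>+ x. indicator ?C (vadd e x (vneg e (\<phi> w))) *
           indicator S (vadd e (\<phi> w) (vadd e x (vneg e (\<phi> w)))) \<partial>?\<nu>)"
      by (rule nn_integral_translate[OF meas, symmetric])
    also have "\<dots> = (\<integral>\<^sup>+ x. indicator ?C (vadd e x (vneg e (\<phi> w))) * indicator S x \<partial>?\<nu>)"
    proof (rule nn_integral_cong)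
      fix x assume "x \<in> space ?\<nu>"
      then have "vadd e (\<phi> w) (vadd e x (vneg e (\<phi> w))) = x"
        by (auto simp: vadd_def vneg_def space_PiM fun_eq_iff PiE_def extensional_def)
      then show "indicator ?C (vadd e x (vneg e (\<phi> w))) *
           indicator S (vadd e (\<phi> w) (vadd e x (vneg e (\<phi> w)))) =
         (indicator ?C (vadd e x (vneg e (\<phi> w))) * indicator S x :: ennreal)" by simp
    qed
    finally show "(\<integral>\<^sup>+ x. indicator ?C x * indicator S (vadd e (\<phi> w) x) \<partial>?\<nu>) =
        (\<integral>\<^sup>+ x. indicator ?C (vadd e x (vneg e (\<phi> w))) * indicator S x \<partial>?\<nu>)" .
  qed
  also have "\<dots> = (\<integral>\<^sup>+ x. (\<integral>\<^sup>+ w. indicator ?C (vadd e x (vneg e (\<phi> w))) * indicator S x \<partial>?\<mu>) \<partial>?\<nu>)"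
    by (rule P.Fubini'[symmetric])
      (unfold case_prod_beta, intro borel_measurable_times_ennreal ind[OF diff_meas unit_cube_sets]
        ind[OF measurable_snd S])
  also have "\<dots> = (\<integral>\<^sup>+ x. indicator S x \<partial>?\<nu>)"
  proof (rule nn_integral_cong)
    fix x assume "x \<in> space ?\<nu>"
    have "(\<lambda>w. vadd e x (vneg e (\<phi> w))) \<in> measurable ?\<mu> ?\<nu>"
      unfolding vadd_def
    proof (intro measurable_into_coord_measure borel_measurable_add)
      show "(\<lambda>w. vneg e (\<phi> w) i) \<in> borel_measurable ?\<mu>" if "i < e" for i
        using that \<phi>_coord by (simp add: vneg_def)
    qed auto
    then show "(\<integral>\<^sup>+ w. indicator ?C (vadd e x (vneg e (\<phi> w))) * indicator S x \<partial>?\<mu>) = indicator S x"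
      by (subst nn_integral_multc) (auto simp: fiber intro: ind[OF _ unit_cube_sets])
  qed
  also have "\<dots> = emeasure ?\<nu> S"
    using S by simp
  finally show ?thesis .
qed

section \<open>Independence of the lattice coordinates\<close>

lemma affine_chart_injD:
  assumes "bij_betw (affine_chart d p b) ({..<d} \<rightarrow>\<^sub>E UNIV) A"
    and "(\<Sum>i<d. x i *\<^sub>R b i) = (\<Sum>i<d. y i *\<^sub>R b i)" "i < d"
  shows "x i = y i"
proof -
  have "affine_chart d p b (restrict x {..<d}) = affine_chart d p b (restrict y {..<d})"
    using assms(2) by (simp add: affine_chart_def)
  then have "restrict x {..<d} = restrict y {..<d}"
    by (rule inj_onD[OF bij_betw_imp_inj_on[OF assms(1)]]) auto
  then show ?thesis using assms(3) by (metis lessThan_iff restrict_apply')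
qed

lemma affine_chart_independent:
  assumes "bij_betw (affine_chart d p b) ({..<d} \<rightarrow>\<^sub>E UNIV) A"
  shows "inj_on b {..<d}" and "independent (b ` {..<d})"
proof -
  show inj: "inj_on b {..<d}"
  proof (rule inj_onI, rule ccontr)
    fix i j assume ij: "i \<in> {..<d}" "j \<in> {..<d}" "b i = b j" "i \<noteq> j"
    let ?\<delta> = "\<lambda>k l. if l = k then 1 else 0 :: real"
    have single: "(\<Sum>l<d. ?\<delta> k l *\<^sub>R b l) = b k" if "k < d" for k
      using that by (simp add: if_distrib[of "\<lambda>c. c *\<^sub>R _"] cong: if_cong)
    have "?\<delta> i i = ?\<delta> j i"
      by (rule affine_chart_injD[OF assms]) (use ij single in auto)
    then show False using ij(4) by simp
  qed
  show "independent (b ` {..<d})"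
  proof (rule independent_if_scalars_zero)
    fix f v assume f: "(\<Sum>v\<in>b ` {..<d}. f v *\<^sub>R v) = 0" and v: "v \<in> b ` {..<d}"
    then obtain i where i: "i < d" "v = b i" by auto
    have "(\<Sum>l<d. f (b l) *\<^sub>R b l) = (\<Sum>l<d. 0 *\<^sub>R b l)"
      using f by (simp add: sum.reindex[OF inj])
    from affine_chart_injD[OF assms this i(1)] show "f v = 0" by (simp add: i)
  qed simp
qed

text \<open>
  Both \<open>p'\<close> and \<open>p' + b' j\<close> have coordinates in the first chart; \<open>q\<close> consists of those of \<open>p'\<close>, and the
  columns of \<open>M\<close> are the differences.
\<close>

lemma affine_chart_change:
  assumes frame: "bij_betw (affine_chart d p b) ({..<d} \<rightarrow>\<^sub>E UNIV) A"
    and frame': "bij_betw (affine_chart d' p' b') ({..<d'} \<rightarrow>\<^sub>E UNIV) A"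
  obtains M q where "\<And>x. affine_chart d p b (affine_coords d' d M q x) = affine_chart d' p' b' x"
    and "\<And>j. j < d' \<Longrightarrow> b' j = (\<Sum>i<d. M i j *\<^sub>R b i)"
proof -
  have chart': "affine_chart d' p' b' x \<in> affine_chart d p b ` ({..<d} \<rightarrow>\<^sub>E UNIV)" for x
  proof -
    have "affine_chart d' p' b' (restrict x {..<d'}) \<in> A"
      by (rule bij_betwE[OF frame', rule_format]) auto
    moreover have "affine_chart d' p' b' (restrict x {..<d'}) = affine_chart d' p' b' x"
      by (simp add: affine_chart_def)
    ultimately show ?thesis using bij_betw_imp_surj_on[OF frame] by simp
  qed
  have "p' \<in> affine_chart d p b ` ({..<d} \<rightarrow>\<^sub>E UNIV)"
    using chart'[of "\<lambda>_. 0"] by (simp add: affine_chart_def)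
  then obtain q where q: "p' = affine_chart d p b q" by blast
  have "p' + b' j \<in> affine_chart d p b ` ({..<d} \<rightarrow>\<^sub>E UNIV)" if "j < d'" for j
    using chart'[of "\<lambda>l. if l = j then 1 else 0"] that
    by (simp add: affine_chart_def if_distrib[of "\<lambda>c. c *\<^sub>R _"] cong: if_cong)
  then have "\<exists>r. \<forall>j<d'. p' + b' j = affine_chart d p b (r j)" by (intro choice) blast
  then obtain r where r: "\<And>j. j < d' \<Longrightarrow> p' + b' j = affine_chart d p b (r j)" by blast
  define M where "M i j = r j i - q i" for i j
  have b': "b' j = (\<Sum>i<d. M i j *\<^sub>R b i)" if "j < d'" for j
  proof -
    have "b' j = affine_chart d p b (r j) - affine_chart d p b q"
      using r[OF that] q by (metis add_diff_cancel_left')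
    then show ?thesis
      by (simp add: affine_chart_def M_def scaleR_diff_left sum_subtractf)
  qed
  have "affine_chart d p b (affine_coords d' d M q x) = affine_chart d' p' b' x" for x
  proof -
    have "(\<Sum>j<d'. x j *\<^sub>R b' j) = (\<Sum>j<d'. \<Sum>i<d. (M i j * x j) *\<^sub>R b i)"
      by (simp add: b' scaleR_sum_right mult.commute)
    also have "\<dots> = (\<Sum>i<d. (\<Sum>j<d'. M i j * x j) *\<^sub>R b i)"
      by (subst sum.swap) (simp add: scaleR_sum_left)
    finally show ?thesis
      by (simp add: affine_chart_def affine_coords_def q scaleR_add_left sum.distrib add.assoc)
  qed
  with b' show thesis using that by blast
qed

lemma lattice_frame_dim_le:
  assumes "bij_betw (affine_chart d p b) ({..<d} \<rightarrow>\<^sub>E UNIV) A"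
    and "bij_betw (affine_chart d' p' b') ({..<d'} \<rightarrow>\<^sub>E UNIV) A"
  shows "d' \<le> d"
proof -
  obtain M q where M: "\<And>j. j < d' \<Longrightarrow> b' j = (\<Sum>i<d. M i j *\<^sub>R b i)"
    using affine_chart_change[OF assms] by metis
  have "b' ` {..<d'} \<subseteq> span (b ` {..<d})"
    using M by (auto intro!: span_sum span_scale intro: span_base)
  then have "card (b' ` {..<d'}) \<le> card (b ` {..<d})"
    using independent_span_bound[OF _ affine_chart_independent(2)[OF assms(2)], of "b ` {..<d}"] by simp
  then show ?thesis
    using card_image[OF affine_chart_independent(1)[OF assms(1)]]
      card_image[OF affine_chart_independent(1)[OF assms(2)]] by simp
qed

text \<open>
  Any frame whose region is measurable computes the normalized volume: the change of coordinates to
  another frame is an affine isomorphism that matches the integer points.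
\<close>

theorem normalized_volume_eq:
  assumes frame: "lattice_frame L (affine hull P) d p b"
    and X: "X = {x \<in> {..<d} \<rightarrow>\<^sub>E UNIV. affine_chart d p b x \<in> P}" "X \<in> sets (coord_measure d)"
  shows "normalized_volume L P = fact d * measure (coord_measure d) X"
  unfolding normalized_volume_def
proof (rule the_equality)
  show "\<exists>d' p b. lattice_frame L (affine hull P) d' p b \<and>
      fact d * measure (coord_measure d) X = fact d' * measure (Pi\<^sub>M {..<d'} (\<lambda>_. lborel))
        {x \<in> {..<d'} \<rightarrow>\<^sub>E UNIV. affine_chart d' p b x \<in> P}"
    using frame X(1) by blast
  fix v
  assume "\<exists>d p b. lattice_frame L (affine hull P) d p b \<and>
      v = fact d * measure (Pi\<^sub>M {..<d} (\<lambda>_. lborel)) {x \<in> {..<d} \<rightarrow>\<^sub>E UNIV. affine_chart d p b x \<in> P}"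
  then obtain d' p' b' where frame': "lattice_frame L (affine hull P) d' p' b'"
    and v: "v = fact d' * measure (coord_measure d') {x \<in> {..<d'} \<rightarrow>\<^sub>E UNIV. affine_chart d' p' b' x \<in> P}"
    by blast
  have bij: "bij_betw (affine_chart d p b) ({..<d} \<rightarrow>\<^sub>E UNIV) (affine hull P)"
    and bij': "bij_betw (affine_chart d' p' b') ({..<d'} \<rightarrow>\<^sub>E UNIV) (affine hull P)"
    and lat: "affine_chart d p b ` coord_lattice d = affine hull P \<inter> L"
    and lat': "affine_chart d' p' b' ` coord_lattice d' = affine hull P \<inter> L"
    using frame frame' by (auto simp: lattice_frame_def)
  obtain M q where chart: "\<And>x. affine_chart d p b (affine_coords d' d M q x) = affine_chart d' p' b' x"
    using affine_chart_change[OF bij bij'] by metis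
  define \<phi> where "\<phi> = affine_coords d' d M q"
  note chart = chart[folded \<phi>_def]
  have \<phi>_space: "\<phi> x \<in> {..<d} \<rightarrow>\<^sub>E UNIV" for x
    unfolding \<phi>_def affine_coords_def by (rule restrict_PiE_iff[THEN iffD2]) simp
  have inj: "\<phi> x = y" if "affine_chart d' p' b' x = affine_chart d p b y" "y \<in> {..<d} \<rightarrow>\<^sub>E UNIV" for x y
    using that chart \<phi>_space by (intro inj_onD[OF bij_betw_imp_inj_on[OF bij]]) auto
  have image: "\<phi> ` U' = U"
    if img: "affine_chart d' p' b' ` U' = affine_chart d p b ` U" and U: "U \<subseteq> {..<d} \<rightarrow>\<^sub>E UNIV" for U U'
  proof
    show "\<phi> ` U' \<subseteq> U"
    proof
      fix y assume "y \<in> \<phi> ` U'"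
      then obtain x where x: "x \<in> U'" "y = \<phi> x" by blast
      then have "affine_chart d' p' b' x \<in> affine_chart d p b ` U" using img by blast
      then obtain u where "affine_chart d' p' b' x = affine_chart d p b u" "u \<in> U" by (rule imageE)
      then show "y \<in> U" using inj U x(2) by blast
    qed
    show "U \<subseteq> \<phi> ` U'"
    proof
      fix u assume u: "u \<in> U"
      then have "affine_chart d p b u \<in> affine_chart d' p' b' ` U'" using img by blast
      then obtain x where "affine_chart d p b u = affine_chart d' p' b' x" "x \<in> U'" by (rule imageE)
      then show "u \<in> \<phi> ` U'" using inj[of x u] u U by (metis imageI subsetD)
    qed
  qed
  have "\<phi> ` ({..<d'} \<rightarrow>\<^sub>E UNIV) = {..<d} \<rightarrow>\<^sub>E UNIV"
    using bij_betw_imp_surj_on[OF bij] bij_betw_imp_surj_on[OF bij'] by (intro image) auto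
  moreover have "inj_on \<phi> ({..<d'} \<rightarrow>\<^sub>E UNIV)"
  proof (rule inj_onI)
    fix x y assume xy: "x \<in> {..<d'} \<rightarrow>\<^sub>E UNIV" "y \<in> {..<d'} \<rightarrow>\<^sub>E UNIV" "\<phi> x = \<phi> y"
    then have "affine_chart d' p' b' x = affine_chart d' p' b' y" by (metis chart)
    then show "x = y" by (rule inj_onD[OF bij_betw_imp_inj_on[OF bij'] _ xy(1,2)])
  qed
  ultimately have "bij_betw \<phi> ({..<d'} \<rightarrow>\<^sub>E UNIV) ({..<d} \<rightarrow>\<^sub>E UNIV)"
    by (rule bij_betw_imageI[rotated])
  moreover have "\<phi> ` coord_lattice d' = coord_lattice d"
  proof (rule image)
    show "affine_chart d' p' b' ` coord_lattice d' = affine_chart d p b ` coord_lattice d"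
      by (simp only: lat lat')
    show "coord_lattice d \<subseteq> {..<d} \<rightarrow>\<^sub>E UNIV" by (rule PiE_mono) simp
  qed
  ultimately have "emeasure (coord_measure d') (\<phi> -` X \<inter> space (coord_measure d')) =
      emeasure (coord_measure d) X"
    unfolding \<phi>_def by (intro emeasure_vimage_lattice_isomorphism X(2))
  moreover have "\<phi> -` X \<inter> space (coord_measure d') =
      {x \<in> {..<d'} \<rightarrow>\<^sub>E UNIV. affine_chart d' p' b' x \<in> P}"
    unfolding X(1) space_coord_measure using \<phi>_space by (auto simp: chart)
  moreover have "d' = d"
    using lattice_frame_dim_le[OF bij bij'] lattice_frame_dim_le[OF bij' bij] by simp
  ultimately show "v = fact d * measure (coord_measure d) X"
    by (simp add: v measure_def)
qed

section \<open>The volume of a flow region\<close>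

definition divpow :: "nat \<Rightarrow> real \<Rightarrow> real" where
  "divpow k x = x ^ k / fact k"

lemma divpow_0 [simp]: "divpow 0 x = 1"
  by (simp add: divpow_def)

lemma divpow_Suc_at_0 [simp]: "divpow (Suc k) 0 = 0"
  by (simp add: divpow_def)

lemma divpow_nonneg: "0 \<le> x \<Longrightarrow> 0 \<le> divpow k x"
  by (simp add: divpow_def)

lemma divpow_Suc_has_derivative:
  "(divpow (Suc k) has_real_derivative divpow k x) (at x)"
proof -
  have "(divpow (Suc k) has_real_derivative (real (Suc k) * x ^ k) / fact (Suc k)) (at x)"
    unfolding divpow_def[abs_def] using DERIV_pow[of "Suc k" x UNIV] by (intro DERIV_cdivide) simp
  moreover have "(real (Suc k) * x ^ k) / fact (Suc k) = divpow k x"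
    by (simp add: divpow_def)
  ultimately show ?thesis by simp
qed

text \<open>
  An antiderivative in \<open>x\<close> of \<open>(a + x)^p / p! * (y - x)^q / q!\<close>, by repeated integration by parts.  It
  vanishes at \<open>x = y\<close>.
\<close>

definition transfer_primitive :: "nat \<Rightarrow> nat \<Rightarrow> real \<Rightarrow> real \<Rightarrow> real \<Rightarrow> real" where
  "transfer_primitive p q a y x = - (\<Sum>i\<le>p. divpow (p - i) (a + x) * divpow (q + i + 1) (y - x))"

text \<open>
  The derivative of the sum telescopes; the induction splits off its first term.
\<close>

lemma transfer_primitive_has_derivative:
  "(transfer_primitive p q a y has_real_derivative divpow p (a + x) * divpow q (y - x)) (at x)"
proof (induction p arbitrary: q)
  have left: "((\<lambda>x. divpow (Suc k) (a + x)) has_real_derivative divpow k (a + x)) (at x)" for k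
    by (rule DERIV_chain2[where g = "\<lambda>x. a + x" and Db = 1, OF divpow_Suc_has_derivative, simplified])
      (auto intro!: derivative_eq_intros)
  have right: "((\<lambda>x. divpow (Suc k) (y - x)) has_real_derivative - divpow k (y - x)) (at x)" for k
    by (rule DERIV_chain2[where g = "\<lambda>x. y - x" and Db = "- 1", OF divpow_Suc_has_derivative, simplified])
      (auto intro!: derivative_eq_intros)
  case 0
  then show ?case
    using DERIV_minus[OF right[of q]] by (simp add: transfer_primitive_def[abs_def])
  case (Suc p)
  have "transfer_primitive (Suc p) q a y = (\<lambda>x. transfer_primitive p (Suc q) a y x
      - divpow (Suc p) (a + x) * divpow (Suc q) (y - x))"
    by (simp add: fun_eq_iff transfer_primitive_def sum.atMost_Suc_shift del: sum.atMost_Suc)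
  moreover have "((\<lambda>x. transfer_primitive p (Suc q) a y x
      - divpow (Suc p) (a + x) * divpow (Suc q) (y - x)) has_real_derivative
      divpow p (a + x) * divpow (Suc q) (y - x)
      - (divpow p (a + x) * divpow (Suc q) (y - x) + - divpow q (y - x) * divpow (Suc p) (a + x)))
      (at x)"
    by (intro DERIV_diff Suc.IH DERIV_mult left right)
  ultimately show ?case by (simp add: mult.commute)
qed

text \<open>
  The exponent vectors that arise when an edge \<open>(u, v)\<close> is added, starting from the products of divided
  powers with exponent vectors in \<open>T\<close>; the index \<open>i\<close> is the part of the exponent at \<open>u\<close> that moves to
  \<open>v\<close>, and the integration itself raises the exponent at \<open>v\<close> by one.
\<close>

definition add_edge :: "nat \<times> nat \<Rightarrow> (nat \<Rightarrow> nat) multiset \<Rightarrow> (nat \<Rightarrow> nat) multiset" where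
  "add_edge e T = (\<Sum>j\<in>#T. image_mset
     (\<lambda>i. j(fst e := j (fst e) - i, snd e := j (snd e) + i + 1)) (mset_set {..j (fst e)}))"

text \<open>
  The head of the list is the edge added first.
\<close>

definition monomials :: "(nat \<times> nat) list \<Rightarrow> (nat \<Rightarrow> nat) multiset" where
  "monomials es = fold add_edge es {#\<lambda>_. 0#}"

lemma monomials_Nil [simp]: "monomials [] = {#\<lambda>_. 0#}"
  by (simp add: monomials_def)

lemma monomials_snoc [simp]: "monomials (es @ [e]) = add_edge e (monomials es)"
  by (simp add: monomials_def)

definition monomial_value :: "nat \<Rightarrow> (nat \<Rightarrow> nat) \<Rightarrow> (nat \<Rightarrow> real) \<Rightarrow> real" where
  "monomial_value N j b = (\<Prod>l\<le>N. divpow (j l) (b l))"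

lemma monomial_value_nonneg: "(\<And>l. 0 \<le> b l) \<Longrightarrow> 0 \<le> monomial_value N j b"
  unfolding monomial_value_def by (intro prod_nonneg divpow_nonneg) auto

lemma monomial_value_split:
  assumes "u \<noteq> v" "u \<le> N" "v \<le> N"
  shows "monomial_value N j b = divpow (j u) (b u) * divpow (j v) (b v) *
    (\<Prod>l\<in>{..N} - {u} - {v}. divpow (j l) (b l))"
proof -
  have "monomial_value N j b = divpow (j u) (b u) * (\<Prod>l\<in>{..N} - {u}. divpow (j l) (b l))"
    unfolding monomial_value_def using assms by (intro prod.remove) auto
  also have "(\<Prod>l\<in>{..N} - {u}. divpow (j l) (b l)) =
      divpow (j v) (b v) * (\<Prod>l\<in>{..N} - {u} - {v}. divpow (j l) (b l))"
    using assms by (intro prod.remove) auto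
  finally show ?thesis by (simp add: mult.assoc)
qed

lemma sum_mset_add_edge:
  "(\<Sum>j\<in>#add_edge e T. g j) =
   (\<Sum>j\<in>#T. \<Sum>i\<le>j (fst e). (g (j(fst e := j (fst e) - i, snd e := j (snd e) + i + 1)) :: real))"
  by (induction T) (auto simp: add_edge_def sum_unfold_sum_mset image_mset.compositionality o_def fun_upd_def)

text \<open>
  One integration step of the volume recursion, carried out on a sum of products of divided powers.
\<close>

lemma monomial_integral:
  assumes uv: "u \<noteq> v" "u \<le> N" "v \<le> N" and b: "\<And>l. 0 \<le> b l"
  shows "(\<integral>\<^sup>+ y. ennreal (\<Sum>j\<in>#T. monomial_value N j (b(u := b u + y, v := b v - y)))
            * indicator {0..b v} y \<partial>lborel)
         = ennreal (\<Sum>j\<in>#add_edge (u, v) T. monomial_value N j b)"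
proof -
  define R where "R j = (\<Prod>l\<in>{..N} - {u} - {v}. divpow (j l) (b l))" for j :: "nat \<Rightarrow> nat"
  have split: "monomial_value N j (b(u := b u + y, v := b v - y)) =
      divpow (j u) (b u + y) * divpow (j v) (b v - y) * R j" for j y
    using uv by (subst monomial_value_split[of u v]) (auto simp: R_def)
  define H where "H y = (\<Sum>j\<in>#T. transfer_primitive (j u) (j v) (b u) (b v) y * R j)" for y
  have deriv: "(H has_real_derivative
      (\<Sum>j\<in>#T. monomial_value N j (b(u := b u + y, v := b v - y)))) (at y)" for y
    unfolding H_def[abs_def] split
    by (induction T) (auto intro!: DERIV_add DERIV_cmult_right transfer_primitive_has_derivative)
  have cont: "continuous_on UNIV (\<lambda>y. \<Sum>j\<in>#T. monomial_value N j (b(u := b u + y, v := b v - y)))"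
    unfolding split divpow_def by (induction T) (auto intro!: continuous_intros)
  have "(\<integral>\<^sup>+ y. ennreal (\<Sum>j\<in>#T. monomial_value N j (b(u := b u + y, v := b v - y)))
            * indicator {0..b v} y \<partial>lborel) = ennreal (H (b v) - H 0)"
  proof (rule nn_integral_FTC_Icc)
    show "(\<lambda>y. \<Sum>j\<in>#T. monomial_value N j (b(u := b u + y, v := b v - y))) \<in> borel_measurable borel"
      by (rule borel_measurable_continuous_onI[OF cont])
    show "0 \<le> (\<Sum>j\<in>#T. monomial_value N j (b(u := b u + y, v := b v - y)))"
      if "y \<in> {0..b v}" for y
    proof -
      have "0 \<le> monomial_value N j (b(u := b u + y, v := b v - y))" for j
        using that b by (intro monomial_value_nonneg) auto
      then show ?thesis by (induction T) (auto intro: add_nonneg_nonneg)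
    qed
  qed (use b deriv in auto)
  also have "H (b v) - H 0 = (\<Sum>j\<in>#T. \<Sum>i\<le>j u.
      divpow (j u - i) (b u) * divpow (j v + i + 1) (b v) * R j)"
    unfolding H_def
    by (induction T) (auto simp: transfer_primitive_def sum_distrib_left algebra_simps)
  also have "\<dots> = (\<Sum>j\<in>#add_edge (u, v) T. monomial_value N j b)"
  proof -
    have "monomial_value N (j(u := j u - i, v := j v + i + 1)) b =
        divpow (j u - i) (b u) * divpow (j v + i + 1) (b v) * R j" for j i
      using uv by (subst monomial_value_split[of u v]) (auto simp: R_def)
    then show ?thesis by (simp add: sum_mset_add_edge)
  qed
  finally show ?thesis .
qed

text \<open>
  The \<open>i\<close>-th coordinate is the flow on the \<open>i\<close>-th edge, and \<open>b l\<close> bounds the amount that stays at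
  vertex \<open>l\<close>.
\<close>

definition flow_region :: "(nat \<times> nat) list \<Rightarrow> (nat \<Rightarrow> real) \<Rightarrow> (nat \<Rightarrow> real) set" where
  "flow_region es b = {x \<in> {..<length es} \<rightarrow>\<^sub>E UNIV. (\<forall>i<length es. 0 \<le> x i) \<and>
     (\<forall>l. (\<Sum>i<length es. if snd (es ! i) = l then x i else 0)
        \<le> b l + (\<Sum>i<length es. if fst (es ! i) = l then x i else 0))}"

lemma flow_region_measurable [measurable]:
  "flow_region es b \<in> sets (Pi\<^sub>M {..<length es} (\<lambda>_. lborel))"
proof -
  have [measurable]: "(\<lambda>x. x i) \<in> borel_measurable (Pi\<^sub>M {..<length es} (\<lambda>_. lborel :: real measure))"
    if "i < length es" for i
    using measurable_component_singleton[of i "{..<length es}" "\<lambda>_. lborel :: real measure"] that by simp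
  have sums: "(\<lambda>x. \<Sum>i<length es. if Q i then x i else 0)
      \<in> borel_measurable (Pi\<^sub>M {..<length es} (\<lambda>_. lborel :: real measure))" for Q
  proof (rule borel_measurable_sum)
    show "(\<lambda>x. if Q i then x i else 0) \<in> borel_measurable (Pi\<^sub>M {..<length es} (\<lambda>_. lborel :: real measure))"
      if "i \<in> {..<length es}" for i
      using that by (cases "Q i") auto
  qed
  have "flow_region es b = {x \<in> space (Pi\<^sub>M {..<length es} (\<lambda>_. lborel)).
      (\<forall>i\<in>{..<length es}. 0 \<le> x i) \<and>
     (\<forall>l. (\<Sum>i<length es. if snd (es ! i) = l then x i else 0)
        \<le> b l + (\<Sum>i<length es. if fst (es ! i) = l then x i else 0))}"
    by (auto simp: flow_region_def space_PiM)
  also have "\<dots> \<in> sets (Pi\<^sub>M {..<length es} (\<lambda>_. lborel))"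
    by (intro sets.sets_Collect_conj sets.sets_Collect_countable_All sets.sets_Collect_finite_All
        borel_measurable_le borel_measurable_add sums borel_measurable_const) auto
  finally show ?thesis .
qed

text \<open>
  An edge \<open>(u, v)\<close> carrying \<open>y\<close> acts on the other edges like a change of \<open>b\<close> at its two ends.  Since
  they contribute no outflow at \<open>v\<close>, the inequality at \<open>v\<close> forces \<open>y \<le> b v\<close>.
\<close>

lemma flow_region_section:
  assumes x: "x \<in> {..<length es} \<rightarrow>\<^sub>E UNIV" and uv: "u \<noteq> v"
    and src: "\<And>e. e \<in> set es \<Longrightarrow> fst e \<noteq> v"
  shows "x(length es := y) \<in> flow_region (es @ [(u, v)]) b \<longleftrightarrow>
    0 \<le> y \<and> y \<le> b v \<and> x \<in> flow_region es (b(u := b u + y, v := b v - y))"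
proof -
  let ?d = "length es"
  define I where "I l = (\<Sum>i<?d. if snd (es ! i) = l then x i else 0)" for l
  define O' where "O' l = (\<Sum>i<?d. if fst (es ! i) = l then x i else 0)" for l
  have O_v: "O' v = 0"
    unfolding O'_def using src by (intro sum.neutral) (auto dest: nth_mem)
  have I_nonneg: "0 \<le> I l" if "\<forall>i<?d. 0 \<le> x i" for l
    unfolding I_def using that by (intro sum_nonneg) auto
  have ins: "(\<Sum>i<length (es @ [(u, v)]). if snd ((es @ [(u, v)]) ! i) = l then (x(?d := y)) i else 0)
      = I l + (if v = l then y else 0)" for l
    by (auto simp: I_def nth_append intro!: sum.cong)
  have outs: "(\<Sum>i<length (es @ [(u, v)]). if fst ((es @ [(u, v)]) ! i) = l then (x(?d := y)) i else 0)
      = O' l + (if u = l then y else 0)" for l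
    by (auto simp: O'_def nth_append intro!: sum.cong)
  have ext: "x(?d := y) \<in> {..<length (es @ [(u, v)])} \<rightarrow>\<^sub>E UNIV"
    using x by (auto simp: PiE_def extensional_def)
  have nonneg: "(\<forall>i<length (es @ [(u, v)]). 0 \<le> (x(?d := y)) i) \<longleftrightarrow> 0 \<le> y \<and> (\<forall>i<?d. 0 \<le> x i)"
    by (auto simp: less_Suc_eq)
  have lhs: "x(?d := y) \<in> flow_region (es @ [(u, v)]) b \<longleftrightarrow> (0 \<le> y \<and> (\<forall>i<?d. 0 \<le> x i)) \<and>
      (\<forall>l. I l + (if v = l then y else 0) \<le> b l + (O' l + (if u = l then y else 0)))"
    unfolding flow_region_def mem_Collect_eq ins outs nonneg using ext by blast
  have rhs: "x \<in> flow_region es (b(u := b u + y, v := b v - y)) \<longleftrightarrow> (\<forall>i<?d. 0 \<le> x i) \<and>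
      (\<forall>l. I l \<le> (b(u := b u + y, v := b v - y)) l + O' l)"
    unfolding flow_region_def mem_Collect_eq I_def O'_def using x by blast
  have shift: "I l + (if v = l then y else 0) \<le> b l + (O' l + (if u = l then y else 0)) \<longleftrightarrow>
      I l \<le> (b(u := b u + y, v := b v - y)) l + O' l" for l
    using uv by auto
  have "y \<le> b v" if "\<forall>i<?d. 0 \<le> x i" "\<forall>l. I l \<le> (b(u := b u + y, v := b v - y)) l + O' l"
    using that(2)[rule_format, of v] I_nonneg[OF that(1), of v] O_v by simp
  then show ?thesis unfolding lhs rhs shift by blast
qed

text \<open>
  Induction on the edges: Fubini's theorem makes the last coordinate the outer integral, and the inner
  one is known for all nonnegative \<open>b\<close>.  Sorting by final vertices guarantees that no edge leaves the
  final vertex of the last one.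
\<close>

theorem emeasure_flow_region:
  assumes "sorted (map snd es)" "\<And>u v. (u, v) \<in> set es \<Longrightarrow> u < v \<and> v \<le> N" "\<And>l. 0 \<le> b l"
  shows "emeasure (Pi\<^sub>M {..<length es} (\<lambda>_. lborel)) (flow_region es b) =
    ennreal (\<Sum>j\<in>#monomials es. monomial_value N j b)"
  using assms
proof (induction es arbitrary: b rule: rev_induct)
  case Nil
  have "flow_region [] b = {\<lambda>_. undefined}"
    using Nil by (auto simp: flow_region_def)
  then show ?case
    by (simp add: PiM_empty monomial_value_def)
next
  case (snoc e es)
  obtain u v where e: "e = (u, v)" by fastforce
  have uv: "u < v" "v \<le> N" using snoc.prems(2)[of u v] e by auto
  have src: "fst e' \<noteq> v" if "e' \<in> set es" for e'
  proof -
    have "snd e' \<le> v" using snoc.prems(1) that by (auto simp: sorted_append e)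
    moreover have "fst e' < snd e'" using snoc.prems(2)[of "fst e'" "snd e'"] that by auto
    ultimately show ?thesis by simp
  qed
  interpret product_sigma_finite "\<lambda>_ :: nat. lborel :: real measure" by standard
  let ?d = "length es" and ?R = "flow_region (es @ [e]) b"
  have R: "?R \<in> sets (Pi\<^sub>M (insert ?d {..<?d}) (\<lambda>_. lborel))"
    using flow_region_measurable[of "es @ [e]" b] by (simp add: lessThan_Suc)
  have "emeasure (Pi\<^sub>M {..<length (es @ [e])} (\<lambda>_. lborel)) ?R =
      (\<integral>\<^sup>+ x. indicator ?R x \<partial>Pi\<^sub>M (insert ?d {..<?d}) (\<lambda>_. lborel))"
    using R by (simp add: lessThan_Suc)
  also have "\<dots> = (\<integral>\<^sup>+ y. (\<integral>\<^sup>+ x. indicator ?R (x(?d := y)) \<partial>Pi\<^sub>M {..<?d} (\<lambda>_. lborel)) \<partial>lborel)"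
    using R by (intro product_nn_integral_insert_rev) auto
  also have "\<dots> = (\<integral>\<^sup>+ y. ennreal (\<Sum>j\<in>#monomials es. monomial_value N j (b(u := b u + y, v := b v - y)))
            * indicator {0..b v} y \<partial>lborel)"
  proof (rule nn_integral_cong)
    fix y :: real
    let ?b = "b(u := b u + y, v := b v - y)"
    have "(\<integral>\<^sup>+ x. indicator ?R (x(?d := y)) \<partial>Pi\<^sub>M {..<?d} (\<lambda>_. lborel)) =
        (\<integral>\<^sup>+ x. indicator {0..b v} y * indicator (flow_region es ?b) x \<partial>Pi\<^sub>M {..<?d} (\<lambda>_. lborel))"
    proof (rule nn_integral_cong)
      fix x assume "x \<in> space (Pi\<^sub>M {..<?d} (\<lambda>_. lborel :: real measure))"
      then have "x \<in> {..<?d} \<rightarrow>\<^sub>E UNIV" by (simp add: space_PiM)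
      from flow_region_section[OF this, of u v y b] uv src
      show "(indicator ?R (x(?d := y)) :: ennreal) =
          indicator {0..b v} y * indicator (flow_region es ?b) x"
        by (auto simp: e indicator_def)
    qed
    also have "\<dots> = indicator {0..b v} y * emeasure (Pi\<^sub>M {..<?d} (\<lambda>_. lborel)) (flow_region es ?b)"
      by (simp add: nn_integral_cmult)
    also have "\<dots> = ennreal (\<Sum>j\<in>#monomials es. monomial_value N j ?b) * indicator {0..b v} y"
    proof (cases "y \<in> {0..b v}")
      case True
      have "0 \<le> ?b l" for l using True snoc.prems(3)[of l] by auto
      moreover have "sorted (map snd es)" using snoc.prems(1) by (simp add: sorted_append)
      ultimately show ?thesis using snoc.prems(2) by (subst snoc.IH) (auto simp: mult.commute)
    qed simp
    finally show "(\<integral>\<^sup>+ x. indicator ?R (x(?d := y)) \<partial>Pi\<^sub>M {..<?d} (\<lambda>_. lborel)) =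
      ennreal (\<Sum>j\<in>#monomials es. monomial_value N j ?b) * indicator {0..b v} y" .
  qed
  also have "\<dots> = ennreal (\<Sum>j\<in>#monomials (es @ [e]). monomial_value N j b)"
    using uv snoc.prems(3) by (subst monomial_integral) (auto simp: e)
  finally show ?case .
qed

section \<open>Counting the divided power monomials\<close>

text \<open>
  For given \<open>i\<close> the change of exponents is injective on the vectors whose entry at \<open>u\<close> is at
  least \<open>i\<close>, and \<open>i < j v\<close> is the condition that \<open>j\<close> lies
  in its image.
\<close>

lemma count_add_edge:
  assumes "u \<noteq> v"
  shows "count (add_edge (u, v) T) j = (\<Sum>i<j v. count T (j(u := j u + i, v := j v - i - 1)))"
proof (induction T)
  case empty
  then show ?case by (simp add: add_edge_def)
next
  case (add k T)
  let ?g = "\<lambda>i. k(u := k u - i, v := k v + i + 1)" and ?h = "\<lambda>i. j(u := j u + i, v := j v - i - 1)"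
  have "?g i = j \<and> i \<le> k u \<longleftrightarrow> k = ?h i \<and> i < j v" for i
    using assms by (auto simp: fun_eq_iff)
  then have sets: "{i \<in> {..k u}. ?g i = j} = {i \<in> {..<j v}. k = ?h i}" by auto
  have "count (image_mset ?g (mset_set {..k u})) j = card {i \<in> {..k u}. ?g i = j}"
    by (simp add: count_image_mset vimage_def Int_def conj_commute)
  also have "\<dots> = (\<Sum>i<j v. if k = ?h i then 1 else 0)"
    unfolding sets by (simp only: sum.If_cases[OF finite_lessThan] card_eq_sum Int_def mem_Collect_eq
        sum.neutral_const add_0_right)
  finally have new: "count (image_mset ?g (mset_set {..k u})) j = (\<Sum>i<j v. if k = ?h i then 1 else 0)" .
  have "add_edge (u, v) (add_mset k T) = image_mset ?g (mset_set {..k u}) + add_edge (u, v) T"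
    by (simp add: add_edge_def)
  then have "count (add_edge (u, v) (add_mset k T)) j =
      (\<Sum>i<j v. if k = ?h i then 1 else 0) + (\<Sum>i<j v. count T (?h i))"
    by (simp only: count_union new add)
  also have "\<dots> = (\<Sum>i<j v. count (add_mset k T) (?h i))"
    unfolding sum.distrib[symmetric] by (rule sum.cong) simp_all
  finally show ?case .
qed

lemma sum_fun_upd2:
  fixes j :: "nat \<Rightarrow> nat"
  assumes "u \<noteq> v" "u \<le> N" "v \<le> N"
  shows "(\<Sum>l\<le>N. (j(u := a, v := b)) l) + j u + j v = (\<Sum>l\<le>N. j l) + a + b"
proof -
  have split: "(\<Sum>l\<le>N. f l) = f u + (f v + (\<Sum>l\<in>{..N} - {u} - {v}. f l))" for f :: "nat \<Rightarrow> nat"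
    using assms by (subst sum.remove[of _ u], simp, simp, subst sum.remove[of _ v]) auto
  have "(\<Sum>l\<in>{..N} - {u} - {v}. (j(u := a, v := b)) l) = (\<Sum>l\<in>{..N} - {u} - {v}. j l)"
    by (rule sum.cong) auto
  then show ?thesis using assms(1) by (simp add: split)
qed

lemma monomials_homogeneous:
  assumes "\<And>u v. (u, v) \<in> set es \<Longrightarrow> u < v \<and> v \<le> N" "j \<in># monomials es"
  shows "(\<Sum>l\<le>N. j l) = length es" and "N < l \<Longrightarrow> j l = 0"
proof -
  have "(\<Sum>l\<le>N. j l) = length es \<and> (\<forall>l>N. j l = 0)"
    using assms
  proof (induction es arbitrary: j rule: rev_induct)
    case (snoc e es)
    obtain u v where e: "e = (u, v)" by fastforce
    have uv: "u < v" "v \<le> N" using snoc.prems(1)[of u v] e by auto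
    obtain k i where k: "k \<in># monomials es" "i \<le> k u" "j = k(u := k u - i, v := k v + i + 1)"
      using snoc.prems(2) by (auto simp: add_edge_def e)
    have "(\<Sum>l\<le>N. k l) = length es \<and> (\<forall>l>N. k l = 0)"
      using snoc.prems(1) k(1) by (intro snoc.IH) auto
    then show ?case
      using uv k sum_fun_upd2[of u v N k "k u - i" "k v + i + 1"] by auto
  qed simp
  then show "(\<Sum>l\<le>N. j l) = length es" "N < l \<Longrightarrow> j l = 0" by auto
qed

text \<open>
  By homogeneity, an exponent vector with no positive entry below \<open>N\<close> has all of its degree at \<open>N\<close>.
\<close>

lemma sum_monomial_values_at_sink:
  assumes "\<And>u v. (u, v) \<in> set es \<Longrightarrow> u < v \<and> v \<le> N"
  shows "(\<Sum>j\<in>#monomials es. monomial_value N j (\<lambda>l. if l = N then 1 else 0)) =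
    real (count (monomials es) (\<lambda>l. if l = N then length es else 0)) / fact (length es)"
proof -
  let ?k = "\<lambda>l. if l = N then length es else 0"
  have "monomial_value N j (\<lambda>l. if l = N then 1 else 0) = (if j = ?k then 1 / fact (length es) else 0)"
    if j: "j \<in># monomials es" for j
  proof (cases "j = ?k")
    case True
    then show ?thesis
      by (simp add: monomial_value_def divpow_def lessThan_Suc_atMost[symmetric])
  next
    case False
    have "\<exists>l<N. j l \<noteq> 0"
    proof (rule ccontr)
      assume "\<not> (\<exists>l<N. j l \<noteq> 0)"
      then have below: "j l = 0" if "l < N" for l using that by blast
      have "j N = length es"
        using monomials_homogeneous(1)[OF assms j] below by (simp add: lessThan_Suc_atMost[symmetric])
      then have "j = ?k"
        using below monomials_homogeneous(2)[OF assms j] by (auto simp: fun_eq_iff) (metis nat_neq_iff)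
      with False show False ..
    qed
    then obtain l where "l < N" "j l \<noteq> 0" by blast
    then have "divpow (j l) (if l = N then 1 else 0) = 0" by (cases "j l") auto
    with \<open>l < N\<close> False show ?thesis by (auto simp: monomial_value_def intro!: prod_zero)
  qed
  then have "(\<Sum>j\<in>#monomials es. monomial_value N j (\<lambda>l. if l = N then 1 else 0)) =
      (\<Sum>j\<in>#monomials es. if j = ?k then 1 / fact (length es) else 0)"
    by (intro arg_cong[of _ _ sum_mset] image_mset_cong)
  also have "\<dots> = real (count (monomials es) ?k) / fact (length es)"
    by (induction "monomials es" rule: multiset_induct) (simp_all add: sum_mset_delta)
  finally show ?thesis .
qed

section \<open>Multiplicities as coefficients of a product of geometric series\<close>

text \<open>
  The exponent vector of \<open>(x_u / x_v)^i\<close> for \<open>e = (u, v)\<close>, with \<open>x_N = 1\<close>.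
\<close>

definition edge_expo :: "nat \<Rightarrow> nat \<times> nat \<Rightarrow> int \<Rightarrow> expo" where
  "edge_expo N e i = xpow (fst e) i - (if snd e < N then xpow (snd e) i else 0)"

definition edge_series :: "nat \<Rightarrow> (nat \<times> nat) list \<Rightarrow> real laurent" where
  "edge_series N es = (\<Prod>e\<leftarrow>es. geom_series (edge_expo N e 1))"

lemma lookup_edge_expo:
  "Poly_Mapping.lookup (edge_expo N e i) l =
    (if l = fst e then i else 0) - (if l = snd e \<and> snd e < N then i else 0)"
  by (auto simp: edge_expo_def lookup_minus lookup_single when_def)

lemma coeff_geom_edge:
  assumes "u < v"
  shows "lcoeff (geom_series (edge_expo N (u, v) 1) :: real laurent) b =
    (if \<exists>m::nat. b = edge_expo N (u, v) (int m) then 1 else 0)"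
proof -
  have "0 \<le> psum (edge_expo N (u, v) 1) k" for k
    using assms by (auto simp: edge_expo_def psum_diff psum_xpow)
  moreover have "(\<forall>i. Poly_Mapping.lookup b i = int m * Poly_Mapping.lookup (edge_expo N (u, v) 1) i)
      \<longleftrightarrow> b = edge_expo N (u, v) (int m)" for m
    by (auto simp: poly_mapping_eq_iff fun_eq_iff lookup_edge_expo)
  ultimately show ?thesis by (simp add: geom_series.rep_eq)
qed

text \<open>
  The three properties hold for each power of \<open>x_u / x_v\<close> and pass to products; they bound the
  summation ranges when an edge is added.
\<close>

lemma edge_series_support:
  assumes "\<And>u v. (u, v) \<in> set es \<Longrightarrow> u < v" "lcoeff (edge_series N es) c \<noteq> 0"
  shows "0 \<le> psum c k"
    and "\<And>l. l \<notin> fst ` set es \<Longrightarrow> Poly_Mapping.lookup c l \<le> 0"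
    and "\<And>l. l \<notin> fst ` set es \<Longrightarrow> l \<notin> snd ` set es \<or> N \<le> l \<Longrightarrow> Poly_Mapping.lookup c l = 0"
proof -
  have "0 \<le> psum c k \<and> (\<forall>l. l \<notin> fst ` set es \<longrightarrow> Poly_Mapping.lookup c l \<le> 0) \<and>
     (\<forall>l. l \<notin> fst ` set es \<and> (l \<notin> snd ` set es \<or> N \<le> l) \<longrightarrow> Poly_Mapping.lookup c l = 0)"
    using assms
  proof (induction es arbitrary: c)
    case Nil
    then have "c = 0" by (simp add: edge_series_def one_laurent_def lmonom.rep_eq split: if_splits)
    then show ?case by simp
  next
    case (Cons e es)
    obtain u v where e: "e = (u, v)" by fastforce
    have uv: "u < v" using Cons.prems(1) e by auto
    have "lcoeff (geom_series (edge_expo N e 1) * edge_series N es) c \<noteq> 0"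
      using Cons.prems(2) by (simp add: edge_series_def)
    then obtain b where b: "lcoeff (geom_series (edge_expo N e 1) :: real laurent) b \<noteq> 0"
      "lcoeff (edge_series N es) (c - b) \<noteq> 0"
      by (rule coeff_times_nonzero)
    from b(1) obtain m :: nat where m: "b = edge_expo N (u, v) (int m)"
      unfolding e coeff_geom_edge[OF uv] by (auto split: if_splits)
    have IH: "0 \<le> psum (c - b) k"
      "\<forall>l. l \<notin> fst ` set es \<longrightarrow> Poly_Mapping.lookup (c - b) l \<le> 0"
      "\<forall>l. l \<notin> fst ` set es \<and> (l \<notin> snd ` set es \<or> N \<le> l) \<longrightarrow> Poly_Mapping.lookup (c - b) l = 0"
      using Cons.IH[OF _ b(2)] Cons.prems(1) by auto
    have "0 \<le> psum b k" using uv by (auto simp: m edge_expo_def psum_diff psum_xpow)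
    then have "0 \<le> psum c k" using IH(1) by (simp add: psum_diff)
    moreover have "Poly_Mapping.lookup c l \<le> 0" if "l \<notin> fst ` set (e # es)" for l
      using IH(2)[rule_format, of l] that
      by (auto simp: lookup_minus m lookup_edge_expo e split: if_splits)
    moreover have "Poly_Mapping.lookup c l = 0"
      if "l \<notin> fst ` set (e # es)" "l \<notin> snd ` set (e # es) \<or> N \<le> l" for l
      using IH(3)[rule_format, of l] that
      by (auto simp: lookup_minus m lookup_edge_expo e split: if_splits)
    ultimately show ?case by blast
  qed
  then show "0 \<le> psum c k"
    and "\<And>l. l \<notin> fst ` set es \<Longrightarrow> Poly_Mapping.lookup c l \<le> 0"
    and "\<And>l. l \<notin> fst ` set es \<Longrightarrow> l \<notin> snd ` set es \<or> N \<le> l \<Longrightarrow> Poly_Mapping.lookup c l = 0"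
    by blast+
qed

definition indegree :: "(nat \<times> nat) list \<Rightarrow> nat \<Rightarrow> nat" where
  "indegree es l = length (filter (\<lambda>e. snd e = l) es)"

definition excess_expo :: "nat \<Rightarrow> (nat \<times> nat) list \<Rightarrow> (nat \<Rightarrow> nat) \<Rightarrow> expo" where
  "excess_expo N es j = (\<Sum>l<N. xpow l (int (indegree es l) - int (j l)))"

lemma lookup_excess_expo:
  "Poly_Mapping.lookup (excess_expo N es j) l =
    (if l < N then int (indegree es l) - int (j l) else 0)"
  by (auto simp: excess_expo_def lookup_sum lookup_single when_def)

lemma sum_indegree_le: "(\<Sum>l<N. indegree es l) \<le> length es"
proof (induction es)
  case (Cons e es)
  have "(\<Sum>l<N. indegree (e # es) l) = (\<Sum>l<N. if snd e = l then 1 else 0) + (\<Sum>l<N. indegree es l)"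
    unfolding sum.distrib[symmetric] by (intro sum.cong) (auto simp: indegree_def)
  with Cons show ?case by simp
qed (simp add: indegree_def)

text \<open>
  Both sides satisfy the same recursion when an edge \<open>(u, v)\<close> is added, except that the multiplicity
  sums over \<open>i < j v\<close> and the coefficient over all \<open>i\<close>.  The terms with \<open>i \<ge> j v\<close> vanish.  For \<open>v < N\<close> they
  would need a positive exponent of \<open>x_v\<close>, although \<open>x_v\<close> occurs only in denominators.  For \<open>v = N\<close> they
  would need a negative total exponent, although every \<open>x_u / x_v\<close> has nonnegative total exponent;
  here the total degree of \<open>j\<close> enters.
\<close>

theorem count_monomials_eq_coeff:
  assumes "sorted (map snd es)" "\<And>u v. (u, v) \<in> set es \<Longrightarrow> u < v \<and> v \<le> N"
    and "(\<Sum>l\<le>N. j l) = length es" "\<And>l. N < l \<Longrightarrow> j l = 0"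
  shows "real (count (monomials es) j) = lcoeff (edge_series N es) (excess_expo N es j)"
  using assms
proof (induction es arbitrary: j rule: rev_induct)
  case Nil
  have "j = (\<lambda>_. 0)"
    using Nil(3,4) by (auto simp: fun_eq_iff) (meson atMost_iff not_le)
  moreover have "excess_expo N [] (\<lambda>_. 0) = 0"
    by (simp add: excess_expo_def indegree_def)
  ultimately show ?case by (simp add: edge_series_def one_laurent_def lmonom.rep_eq)
next
  case (snoc e es)
  obtain u v where e: "e = (u, v)" by fastforce
  have uv: "u < v" "v \<le> N" using snoc.prems(2)[of u v] e by auto
  have es: "u' < v' \<and> v' \<le> N" if "(u', v') \<in> set es" for u' v'
    using snoc.prems(2) that by auto
  have src: "v \<notin> fst ` set es"
  proof
    assume "v \<in> fst ` set es"
    then obtain w where w: "(v, w) \<in> set es" by force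
    then have "w \<le> v" using snoc.prems(1) by (force simp: sorted_append e)
    with es[OF w] show False by simp
  qed
  define c where "c = excess_expo N (es @ [e]) j"
  define h where "h i = j(u := j u + i, v := j v - i - 1)" for i
  let ?E = "\<lambda>m::nat. edge_expo N (u, v) (int m)"
  have indeg: "indegree (es @ [e]) l = indegree es l + (if l = v then 1 else 0)" for l
    by (auto simp: indegree_def e)
  have trunc: "m < j v" if nz: "lcoeff (edge_series N es) (c - ?E m) \<noteq> 0" for m
  proof (cases "v < N")
    case True
    have "Poly_Mapping.lookup (c - ?E m) v \<le> 0"
      using es nz src by (intro edge_series_support(2)[of es]) auto
    then show ?thesis
      using True uv by (simp add: c_def lookup_minus lookup_excess_expo lookup_edge_expo indeg)
  next
    case False
    then have vN: "v = N" using uv by simp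
    have "0 \<le> psum (c - ?E m) N"
      using es nz by (intro edge_series_support(1)[of es]) auto
    moreover have "psum (?E m) N = int m"
      using uv vN by (simp add: edge_expo_def psum_xpow)
    moreover have "psum c N = (\<Sum>l<N. int (indegree es l)) - (\<Sum>l<N. int (j l))"
      by (simp add: psum_def c_def lookup_excess_expo lessThan_Suc_atMost[symmetric] indeg vN
          sum_subtractf)
    moreover have "(\<Sum>l<N. int (indegree es l)) \<le> int (length es)"
      using sum_indegree_le[of es N] by (metis of_nat_le_iff of_nat_sum)
    moreover have "(\<Sum>l<N. int (j l)) + int (j N) = int (length es) + 1"
      using snoc.prems(3) by (simp add: lessThan_Suc_atMost[symmetric] flip: of_nat_sum of_nat_add)
    ultimately show ?thesis by (simp add: psum_diff vN)
  qed
  have shift: "c - ?E i = excess_expo N es (h i)" if "i < j v" for i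
    using that uv
    by (intro poly_mapping_eqI)
      (auto simp: c_def lookup_minus lookup_excess_expo lookup_edge_expo indeg h_def of_nat_diff)
  have "lcoeff (edge_series N (es @ [e])) c =
      lcoeff (geom_series (edge_expo N (u, v) 1) * edge_series N es) c"
    by (simp add: edge_series_def e mult.commute)
  also have "\<dots> = (\<Sum>b\<in>?E ` {..<j v}.
      lcoeff (geom_series (edge_expo N (u, v) 1)) b * lcoeff (edge_series N es) (c - b))"
    by (rule coeff_times_superset)
      (use trunc in \<open>auto simp: coeff_geom_edge[OF uv(1)] split: if_splits\<close>)
  also have "\<dots> = (\<Sum>i<j v. lcoeff (edge_series N es) (c - ?E i))"
  proof (subst sum.reindex)
    show "inj_on ?E {..<j v}"
    proof (rule inj_onI)
      fix a b assume "?E a = ?E b"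
      then have "Poly_Mapping.lookup (?E a) u = Poly_Mapping.lookup (?E b) u" by simp
      then show "a = b" using uv by (simp add: lookup_edge_expo)
    qed
    show "sum ((\<lambda>b. lcoeff (geom_series (edge_expo N (u, v) 1)) b * lcoeff (edge_series N es) (c - b)) \<circ> ?E)
        {..<j v} = (\<Sum>i<j v. lcoeff (edge_series N es) (c - ?E i))"
      by (intro sum.cong) (auto simp: coeff_geom_edge[OF uv(1)])
  qed
  also have "\<dots> = (\<Sum>i<j v. real (count (monomials es) (h i)))"
  proof (rule sum.cong[OF refl])
    fix i assume i: "i \<in> {..<j v}"
    have "(\<Sum>l\<le>N. h i l) = length es"
      using sum_fun_upd2[of u v N j "j u + i" "j v - i - 1"] uv i snoc.prems(3) by (simp add: h_def)
    moreover have "h i l = 0" if "N < l" for l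
      using that uv snoc.prems(4)[of l] by (simp add: h_def)
    ultimately have "real (count (monomials es) (h i)) =
        lcoeff (edge_series N es) (excess_expo N es (h i))"
      using snoc.prems(1) es by (intro snoc.IH) (auto simp: sorted_append)
    then show "lcoeff (edge_series N es) (c - ?E i) = real (count (monomials es) (h i))"
      using shift i by simp
  qed
  also have "\<dots> = real (count (monomials (es @ [e])) j)"
    using uv by (simp add: e count_add_edge h_def)
  finally show ?case by (simp add: c_def)
qed

section \<open>Lattice coordinates on the flow polytope\<close>

lemma lookup_scaleR:
  fixes f :: "'a \<Rightarrow>\<^sub>0 'b::real_vector"
  shows "Poly_Mapping.lookup (r *\<^sub>R f) x = r *\<^sub>R Poly_Mapping.lookup f x"
proof -
  have "finite {x. r *\<^sub>R Poly_Mapping.lookup f x \<noteq> 0}"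
    by (rule finite_subset[OF _ finite_keys[of f]]) (auto simp: in_keys_iff)
  then show ?thesis by (simp add: scaleR_poly_mapping_def)
qed

lemma image_mset_fst_edge_set: "image_mset fst (mset_set (edge_set G)) = G"
  and finite_edge_set: "finite (edge_set G)"
proof -
  have "edge_set G = (\<Union>e\<in>set_mset G. {e} \<times> {..<count G e})"
    by (auto simp: edge_set_def) (metis count_greater_zero_iff gr_implies_not0 gr0I)
  then show fin: "finite (edge_set G)" by simp
  show "image_mset fst (mset_set (edge_set G)) = G"
  proof (rule multiset_eqI)
    fix e
    have "{x \<in> edge_set G. fst x = e} = {e} \<times> {..<count G e}"
      by (auto simp: edge_set_def)
    then have "card {x \<in> edge_set G. fst x = e} = count G e"
      by (simp add: card_cartesian_product_singleton)
    then show "count (image_mset fst (mset_set (edge_set G))) e = count G e"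
      using fin by (simp add: count_image_mset vimage_def Int_def conj_commute)
  qed
qed

locale source_sink_graph =
  fixes n :: nat and G :: edges
  assumes multigraph: "multigraph_on {1..n + 1} G"
begin

definition free_edges :: "((nat \<times> nat) \<times> nat) set" where
  "free_edges = edge_set G \<union> (\<lambda>i. ((i, n + 2), 0)) ` {1..n}"

text \<open>
  Merges the sink \<open>n + 2\<close> with the vertex \<open>n + 1\<close>.
\<close>

definition ends :: "(nat \<times> nat) \<times> nat \<Rightarrow> nat \<times> nat" where
  "ends e = (fst (fst e), min (snd (fst e)) (n + 1))"

abbreviation last_edge :: "(nat \<times> nat) \<times> nat" where
  "last_edge \<equiv> ((n + 1, n + 2), 0)"

abbreviation first_edge :: "nat \<Rightarrow> (nat \<times> nat) \<times> nat" where
  "first_edge l \<equiv> ((0, l), 0)"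

abbreviation all_edges :: "((nat \<times> nat) \<times> nat) set" where
  "all_edges \<equiv> edge_set (extended_graph n G)"

abbreviation polytope :: "((nat \<times> nat) \<times> nat \<Rightarrow>\<^sub>0 real) set" where
  "polytope \<equiv> flow_polytope {0..n + 2} (extended_graph n G)"

lemma edge_set_G:
  assumes "e \<in> edge_set G"
  shows "1 \<le> fst (fst e)" "fst (fst e) < snd (fst e)" "snd (fst e) \<le> n + 1"
proof -
  obtain u v k where e: "e = ((u, v), k)" by (metis surj_pair)
  have "(u, v) \<in># G"
    using assms by (auto simp: edge_set_def e) (metis count_greater_zero_iff gr_implies_not0 gr0I)
  then show "1 \<le> fst (fst e)" "fst (fst e) < snd (fst e)" "snd (fst e) \<le> n + 1"
    using multigraph by (auto simp: multigraph_on_def e)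
qed

lemma finite_free_edges: "finite free_edges"
  by (simp add: free_edges_def finite_edge_set)

lemma ends_free_edges:
  assumes "e \<in> free_edges"
  shows "1 \<le> fst (ends e)" "fst (ends e) \<le> n" "fst (ends e) < snd (ends e)" "snd (ends e) \<le> n + 1"
  using assms edge_set_G[of e] by (auto simp: free_edges_def ends_def)

lemma free_edges_props:
  assumes "e \<in> free_edges"
  shows "1 \<le> fst (fst e)" "fst (fst e) \<le> n" "1 \<le> snd (fst e)" "snd (fst e) \<le> n + 2"
    "e \<noteq> last_edge" "e \<noteq> first_edge l"
  using assms edge_set_G[of e] by (auto simp: free_edges_def)

lemma count_extended_graph:
  "count (extended_graph n G) (i, j) =
    count G (i, j) + (if (i = 0 \<and> j \<in> {1..n + 1}) \<or> (j = n + 2 \<and> i \<in> {1..n + 1}) then 1 else 0)"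
  by (auto simp: extended_graph_def count_mset_set')

lemma all_edges_eq: "all_edges = free_edges \<union> first_edge ` {1..n + 1} \<union> {last_edge}"
proof (rule set_eqI)
  fix e :: "(nat \<times> nat) \<times> nat"
  obtain i j k where e: "e = ((i, j), k)" by (metis surj_pair)
  have "count G (i, j) = 0" if "i = 0 \<or> j = n + 2"
  proof (rule ccontr)
    assume "count G (i, j) \<noteq> 0"
    then have "((i, j), 0) \<in> edge_set G" by (simp add: edge_set_def)
    from edge_set_G[OF this] that show False by auto
  qed
  then show "e \<in> all_edges \<longleftrightarrow> e \<in> free_edges \<union> first_edge ` {1..n + 1} \<union> {last_edge}"
    by (auto simp: e edge_set_def free_edges_def count_extended_graph)
qed

lemma finite_all_edges: "finite all_edges"
  by (rule finite_edge_set)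

lemma sum_all_edges:
  "(\<Sum>e\<in>all_edges. g e) = (\<Sum>e\<in>free_edges. g e) + (\<Sum>l=1..n + 1. g (first_edge l)) + g last_edge"
  for g :: "_ \<Rightarrow> real"
proof -
  have d1: "free_edges \<inter> first_edge ` {1..n + 1} = {}"
    using free_edges_props(6) by blast
  have d2: "(free_edges \<union> first_edge ` {1..n + 1}) \<inter> {last_edge} = {}"
    using free_edges_props(5) by auto
  have "(\<Sum>e\<in>all_edges. g e) = (\<Sum>e\<in>free_edges \<union> first_edge ` {1..n + 1}. g e) + g last_edge"
    unfolding all_edges_eq using finite_free_edges by (subst sum.union_disjoint[OF _ _ d2]) auto
  also have "(\<Sum>e\<in>free_edges \<union> first_edge ` {1..n + 1}. g e) =
      (\<Sum>e\<in>free_edges. g e) + (\<Sum>e\<in>first_edge ` {1..n + 1}. g e)"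
    using finite_free_edges by (subst sum.union_disjoint[OF _ _ d1]) auto
  also have "(\<Sum>e\<in>first_edge ` {1..n + 1}. g e) = (\<Sum>l=1..n + 1. g (first_edge l))"
    by (subst sum.reindex) (auto simp: inj_on_def)
  finally show ?thesis .
qed

text \<open>
  The change of the flow when the value on the free edge \<open>e\<close> grows by one and the values on the other
  free edges are kept.
\<close>

definition direction :: "(nat \<times> nat) \<times> nat \<Rightarrow> ((nat \<times> nat) \<times> nat \<Rightarrow>\<^sub>0 real)" where
  "direction e = Poly_Mapping.single e 1 -
     (if snd (fst e) = n + 2 then Poly_Mapping.single last_edge 1 else 0) +
     Poly_Mapping.single (first_edge (fst (ends e))) 1 -
     Poly_Mapping.single (first_edge (snd (ends e))) 1"

text \<open>
  The unit flow along the path through the source, \<open>n + 1\<close> and the sink; it vanishes on all free edges.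
\<close>

definition base_flow :: "(nat \<times> nat) \<times> nat \<Rightarrow>\<^sub>0 real" where
  "base_flow = Poly_Mapping.single (first_edge (n + 1)) 1 + Poly_Mapping.single last_edge 1"

definition completed_flow :: "((nat \<times> nat) \<times> nat \<Rightarrow> real) \<Rightarrow> ((nat \<times> nat) \<times> nat \<Rightarrow>\<^sub>0 real)" where
  "completed_flow y = base_flow + (\<Sum>e\<in>free_edges. y e *\<^sub>R direction e)"

definition outflow :: "((nat \<times> nat) \<times> nat \<Rightarrow> real) \<Rightarrow> nat \<Rightarrow> real" where
  "outflow y l = (\<Sum>e\<in>free_edges. if fst (ends e) = l then y e else 0)"

definition inflow :: "((nat \<times> nat) \<times> nat \<Rightarrow> real) \<Rightarrow> nat \<Rightarrow> real" where
  "inflow y l = (\<Sum>e\<in>free_edges. if snd (ends e) = l then y e else 0)"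

definition sinkflow :: "((nat \<times> nat) \<times> nat \<Rightarrow> real) \<Rightarrow> real" where
  "sinkflow y = (\<Sum>e\<in>free_edges. if snd (fst e) = n + 2 then y e else 0)"

lemma lookup_completed_flow:
  "Poly_Mapping.lookup (completed_flow y) x =
    (if x = first_edge (n + 1) then 1 else 0) + (if x = last_edge then 1 else 0) +
    (\<Sum>e\<in>free_edges. y e * ((if x = e then 1 else 0)
      - (if snd (fst e) = n + 2 \<and> x = last_edge then 1 else 0)
      + (if x = first_edge (fst (ends e)) then 1 else 0)
      - (if x = first_edge (snd (ends e)) then 1 else 0)))"
proof -
  have single: "Poly_Mapping.lookup (Poly_Mapping.single a 1) x = (if x = a then 1 else 0 :: real)" for a
    by (auto simp: lookup_single when_def)
  have "Poly_Mapping.lookup (direction e) x = (if x = e then 1 else 0)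
      - (if snd (fst e) = n + 2 \<and> x = last_edge then 1 else 0)
      + (if x = first_edge (fst (ends e)) then 1 else 0)
      - (if x = first_edge (snd (ends e)) then 1 else 0)" for e
    unfolding direction_def lookup_add lookup_minus
    by (cases "snd (fst e) = n + 2") (simp_all only: single simp_thms if_True if_False lookup_zero)
  then show ?thesis
    by (simp only: completed_flow_def base_flow_def lookup_add lookup_sum lookup_scaleR single
        real_scaleR_def)
qed

lemma lookup_completed_free:
  assumes "x \<in> free_edges"
  shows "Poly_Mapping.lookup (completed_flow y) x = y x"
proof -
  have "Poly_Mapping.lookup (completed_flow y) x = (\<Sum>e\<in>free_edges. if x = e then y e else 0)"
    using free_edges_props(5,6)[OF assms] by (simp add: lookup_completed_flow cong: if_cong)
      (auto intro!: sum.cong)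
  then show ?thesis using assms finite_free_edges by simp
qed

lemma lookup_completed_last:
  "Poly_Mapping.lookup (completed_flow y) last_edge = 1 - sinkflow y"
proof -
  have "(\<Sum>e\<in>free_edges. y e * ((if last_edge = e then 1 else 0)
      - (if snd (fst e) = n + 2 \<and> last_edge = last_edge then 1 else 0)
      + (if last_edge = first_edge (fst (ends e)) then 1 else 0)
      - (if last_edge = first_edge (snd (ends e)) then 1 else 0))) =
      (\<Sum>e\<in>free_edges. - (if snd (fst e) = n + 2 then y e else 0))"
    using free_edges_props(5) by (intro sum.cong) auto
  then show ?thesis
    unfolding lookup_completed_flow by (simp add: sinkflow_def sum_negf)
qed

lemma lookup_completed_first:
  "Poly_Mapping.lookup (completed_flow y) (first_edge l) =
    (if l = n + 1 then 1 else 0) + outflow y l - inflow y l"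
proof -
  have "(\<Sum>e\<in>free_edges. y e * ((if first_edge l = e then 1 else 0)
      - (if snd (fst e) = n + 2 \<and> first_edge l = last_edge then 1 else 0)
      + (if first_edge l = first_edge (fst (ends e)) then 1 else 0)
      - (if first_edge l = first_edge (snd (ends e)) then 1 else 0))) =
      (\<Sum>e\<in>free_edges. (if fst (ends e) = l then y e else 0) - (if snd (ends e) = l then y e else 0))"
    using free_edges_props(6) by (intro sum.cong) auto
  then show ?thesis
    unfolding lookup_completed_flow by (simp add: outflow_def inflow_def sum_subtractf)
qed

lemma lookup_completed_outside:
  assumes "x \<notin> all_edges"
  shows "Poly_Mapping.lookup (completed_flow y) x = 0"
proof -
  have "x \<noteq> last_edge" "x \<noteq> first_edge (n + 1)"
    using assms by (auto simp: all_edges_eq)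
  moreover have "x \<noteq> e" "x \<noteq> first_edge (fst (ends e))" "x \<noteq> first_edge (snd (ends e))"
    if "e \<in> free_edges" for e
    using assms that ends_free_edges[OF that] by (auto simp: all_edges_eq)
  ultimately show ?thesis by (simp add: lookup_completed_flow)
qed

lemma completed_flow_cong:
  "(\<And>e. e \<in> free_edges \<Longrightarrow> y e = z e) \<Longrightarrow> completed_flow y = completed_flow z"
  by (simp add: completed_flow_def)

lemma completed_flow_lookup:
  "completed_flow (Poly_Mapping.lookup (completed_flow y)) = completed_flow y"
  by (rule completed_flow_cong) (rule lookup_completed_free)

lemma filtered_sum_all_edges:
  "(\<Sum>e | e \<in> all_edges \<and> Q e. g e) = (\<Sum>e\<in>free_edges. if Q e then g e else 0) +
    (\<Sum>l=1..n + 1. if Q (first_edge l) then g (first_edge l) else 0) +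
    (if Q last_edge then g last_edge else 0)" for g :: "_ \<Rightarrow> real"
  using sum_all_edges[of "\<lambda>e. if Q e then g e else 0"] finite_all_edges
  by (simp add: sum.inter_filter)

lemma out_total_source:
  "out_total (extended_graph n G) f 0 = (\<Sum>l=1..n + 1. Poly_Mapping.lookup f (first_edge l))"
proof -
  have "(\<Sum>e\<in>free_edges. if fst (fst e) = 0 then Poly_Mapping.lookup f e else 0) = 0"
  proof (rule sum.neutral, rule ballI)
    fix e assume "e \<in> free_edges"
    from free_edges_props(1)[OF this] show "(if fst (fst e) = 0 then Poly_Mapping.lookup f e else 0) = 0"
      by simp
  qed
  then show ?thesis unfolding out_total_def filtered_sum_all_edges by simp
qed

lemma in_total_sink:
  "in_total (extended_graph n G) f (n + 2) =
    sinkflow (Poly_Mapping.lookup f) + Poly_Mapping.lookup f last_edge"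
proof -
  have "(\<Sum>l=1..n + 1. if snd (fst (first_edge l)) = n + 2
      then Poly_Mapping.lookup f (first_edge l) else 0) = 0"
    by (intro sum.neutral) auto
  then show ?thesis unfolding in_total_def filtered_sum_all_edges sinkflow_def by simp
qed

lemma out_total_inner:
  assumes "l \<in> {1..n + 1}"
  shows "out_total (extended_graph n G) f l = outflow (Poly_Mapping.lookup f) l +
    (if l = n + 1 then Poly_Mapping.lookup f last_edge else 0)"
  using assms unfolding out_total_def filtered_sum_all_edges outflow_def
  by (auto simp: ends_def)

lemma in_total_inner:
  assumes "l \<in> {1..n + 1}"
  shows "in_total (extended_graph n G) f l = Poly_Mapping.lookup f (first_edge l) +
    inflow (Poly_Mapping.lookup f) l - (if l = n + 1 then sinkflow (Poly_Mapping.lookup f) else 0)"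
proof -
  let ?f = "Poly_Mapping.lookup f"
  have first: "(\<Sum>k=1..n + 1. if snd (fst (first_edge k)) = l then ?f (first_edge k) else 0) =
      ?f (first_edge l)"
    using assms by simp
  have "(\<Sum>e\<in>free_edges. if snd (fst e) = l then ?f e else 0) =
      (\<Sum>e\<in>free_edges. (if snd (ends e) = l then ?f e else 0) -
        (if l = n + 1 then (if snd (fst e) = n + 2 then ?f e else 0) else 0))"
  proof (rule sum.cong[OF refl])
    fix e assume "e \<in> free_edges"
    from free_edges_props(4)[OF this] show "(if snd (fst e) = l then ?f e else 0) =
        (if snd (ends e) = l then ?f e else 0) -
        (if l = n + 1 then (if snd (fst e) = n + 2 then ?f e else 0) else 0)"
      using assms by (auto simp: ends_def min_def)
  qed
  also have "\<dots> = inflow ?f l - (if l = n + 1 then sinkflow ?f else 0)"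
    by (simp add: inflow_def sinkflow_def sum_subtractf)
  finally show ?thesis
    unfolding in_total_def filtered_sum_all_edges first using assms by simp
qed

lemma sum_outflow: "(\<Sum>l=1..n + 1. outflow y l) = (\<Sum>e\<in>free_edges. y e)"
  and sum_inflow: "(\<Sum>l=1..n + 1. inflow y l) = (\<Sum>e\<in>free_edges. y e)"
proof -
  have "(\<Sum>l=1..n + 1. outflow y l) = (\<Sum>e\<in>free_edges. \<Sum>l=1..n + 1. if fst (ends e) = l then y e else 0)"
    unfolding outflow_def by (rule sum.swap)
  also have "\<dots> = (\<Sum>e\<in>free_edges. y e)"
  proof (rule sum.cong[OF refl])
    fix e assume "e \<in> free_edges"
    from ends_free_edges[OF this] show "(\<Sum>l=1..n + 1. if fst (ends e) = l then y e else 0) = y e"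
      by (subst sum.delta') auto
  qed
  finally show "(\<Sum>l=1..n + 1. outflow y l) = (\<Sum>e\<in>free_edges. y e)" .
  have "(\<Sum>l=1..n + 1. inflow y l) = (\<Sum>e\<in>free_edges. \<Sum>l=1..n + 1. if snd (ends e) = l then y e else 0)"
    unfolding inflow_def by (rule sum.swap)
  also have "\<dots> = (\<Sum>e\<in>free_edges. y e)"
  proof (rule sum.cong[OF refl])
    fix e assume "e \<in> free_edges"
    from ends_free_edges[OF this] show "(\<Sum>l=1..n + 1. if snd (ends e) = l then y e else 0) = y e"
      by (subst sum.delta') auto
  qed
  finally show "(\<Sum>l=1..n + 1. inflow y l) = (\<Sum>e\<in>free_edges. y e)" .
qed

text \<open>
  The equation at \<open>l\<close> determines the value on the edge from the source to \<open>l\<close>, and the equation at the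
  sink that on \<open>last_edge\<close>.  Conversely, the equation at the source follows from the others, since every
  free edge contributes once to an outflow and once to an inflow.
\<close>

lemma flow_equations_iff:
  "Poly_Mapping.keys f \<subseteq> all_edges \<and>
    out_total (extended_graph n G) f 0 = 1 \<and> in_total (extended_graph n G) f (n + 2) = 1 \<and>
    (\<forall>l\<in>{1..n + 1}. in_total (extended_graph n G) f l = out_total (extended_graph n G) f l) \<longleftrightarrow>
   f = completed_flow (Poly_Mapping.lookup f)" (is "?flow \<longleftrightarrow> ?compl")
proof
  let ?f = "Poly_Mapping.lookup f"
  assume flow: ?flow
  then have "in_total (extended_graph n G) f (n + 2) = 1" by blast
  then have last: "?f last_edge = 1 - sinkflow ?f" unfolding in_total_sink by linarith
  have first: "?f (first_edge l) = (if l = n + 1 then 1 else 0) + outflow ?f l - inflow ?f l"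
    if l: "l \<in> {1..n + 1}" for l
  proof -
    have "in_total (extended_graph n G) f l = out_total (extended_graph n G) f l"
      using flow l by blast
    then show ?thesis
      unfolding in_total_inner[OF l] out_total_inner[OF l] last by (simp split: if_splits)
  qed
  show ?compl
  proof (rule poly_mapping_eqI)
    fix x
    consider "x \<in> free_edges" | l where "x = first_edge l" "l \<in> {1..n + 1}" | "x = last_edge"
      | "x \<notin> all_edges" unfolding all_edges_eq by blast
    then show "?f x = Poly_Mapping.lookup (completed_flow ?f) x"
    proof cases
      case 1
      then show ?thesis by (rule lookup_completed_free[symmetric])
    next
      case 2
      show ?thesis unfolding 2(1) lookup_completed_first by (rule first[OF 2(2)])
    next
      case 3
      show ?thesis unfolding 3 lookup_completed_last by (rule last)
    next
      case 4
      then have "x \<notin> Poly_Mapping.keys f" using flow by blast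
      with 4 show ?thesis by (simp add: lookup_completed_outside in_keys_iff)
    qed
  qed
next
  let ?f = "Poly_Mapping.lookup f"
  assume compl: ?compl
  have last: "?f last_edge = 1 - sinkflow ?f"
    by (subst compl) (rule lookup_completed_last)
  have first: "?f (first_edge l) = (if l = n + 1 then 1 else 0) + outflow ?f l - inflow ?f l" for l
    by (subst compl) (rule lookup_completed_first)
  have "?f x = 0" if "x \<notin> all_edges" for x
    by (subst compl) (rule lookup_completed_outside[OF that])
  then have "Poly_Mapping.keys f \<subseteq> all_edges" by (auto simp: in_keys_iff)
  moreover have "out_total (extended_graph n G) f 0 = 1"
  proof -
    have "(\<Sum>l=1..n + 1. if l = n + 1 then 1 else 0) = (1 :: real)" by simp
    then show ?thesis
      unfolding out_total_source first sum_subtractf sum.distrib sum_outflow sum_inflow by simp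
  qed
  moreover have "in_total (extended_graph n G) f (n + 2) = 1"
    unfolding in_total_sink last by linarith
  moreover have "in_total (extended_graph n G) f l = out_total (extended_graph n G) f l"
    if "l \<in> {1..n + 1}" for l
    unfolding in_total_inner[OF that] out_total_inner[OF that] first last
    by (cases "l = n + 1") simp_all
  ultimately show ?flow by blast
qed

lemma polytope_iff:
  "f \<in> polytope \<longleftrightarrow>
    f = completed_flow (Poly_Mapping.lookup f) \<and> (\<forall>e\<in>all_edges. 0 \<le> Poly_Mapping.lookup f e)"
proof -
  have "Min {0..n + 2} = 0" "Max {0..n + 2} = n + 2"
    by (auto intro: Min_eqI Max_eqI)
  moreover have "{0..n + 2} - {0, n + 2} = {1..n + 1}" by auto
  ultimately show ?thesis
    unfolding flow_polytope_def flow_equations_iff[symmetric] by auto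
qed

text \<open>
  The right-hand side says that the values on the free edges and on the edges from the source are
  nonnegative.  The value on \<open>last_edge\<close> is then nonnegative too, because the flow into the sink is part
  of the inflow at the merged vertex \<open>n + 1\<close>.
\<close>

lemma completed_flow_in_polytope_iff:
  "completed_flow y \<in> polytope \<longleftrightarrow> (\<forall>e\<in>free_edges. 0 \<le> y e) \<and>
    (\<forall>l. inflow y l \<le> (if l = n + 1 then 1 else 0) + outflow y l)"
    (is "_ \<longleftrightarrow> ?nonneg \<and> ?balance")
proof -
  let ?c = "Poly_Mapping.lookup (completed_flow y)"
  have first: "0 \<le> ?c (first_edge l) \<longleftrightarrow> inflow y l \<le> (if l = n + 1 then 1 else 0) + outflow y l" for l
    unfolding lookup_completed_first by linarith
  have free: "(\<forall>e\<in>free_edges. 0 \<le> ?c e) \<longleftrightarrow> ?nonneg"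
    by (rule ball_cong[OF refl]) (simp only: lookup_completed_free)
  have mem: "completed_flow y \<in> polytope \<longleftrightarrow> (\<forall>e\<in>all_edges. 0 \<le> ?c e)"
    unfolding polytope_iff completed_flow_lookup by (simp only: simp_thms)
  show ?thesis
  proof
    assume "completed_flow y \<in> polytope"
    then have c: "0 \<le> ?c e" if "e \<in> all_edges" for e using mem that by blast
    have "inflow y l \<le> (if l = n + 1 then 1 else 0) + outflow y l" for l
    proof (cases "l \<in> {1..n + 1}")
      case True
      then have "first_edge l \<in> all_edges" unfolding all_edges_eq by blast
      then show ?thesis using c first by blast
    next
      case False
      have "inflow y l = 0"
        unfolding inflow_def
      proof (rule sum.neutral, rule ballI)
        fix e assume "e \<in> free_edges"
        from ends_free_edges[OF this] False
        show "(if snd (ends e) = l then y e else 0) = 0" by auto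
      qed
      moreover have "outflow y l = 0"
        unfolding outflow_def
      proof (rule sum.neutral, rule ballI)
        fix e assume "e \<in> free_edges"
        from ends_free_edges[OF this] False
        show "(if fst (ends e) = l then y e else 0) = 0" by auto
      qed
      ultimately show ?thesis by simp
    qed
    moreover have "\<forall>e\<in>free_edges. 0 \<le> ?c e" using c unfolding all_edges_eq by blast
    ultimately show "?nonneg \<and> ?balance" using free by blast
  next
    assume yb: "?nonneg \<and> ?balance"
    have "outflow y (n + 1) = 0"
      unfolding outflow_def
    proof (rule sum.neutral, rule ballI)
      fix e assume "e \<in> free_edges"
      from ends_free_edges(2)[OF this]
      show "(if fst (ends e) = n + 1 then y e else 0) = 0" by auto
    qed
    moreover have "sinkflow y \<le> inflow y (n + 1)"
      unfolding sinkflow_def inflow_def using yb by (intro sum_mono) (auto simp: ends_def)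
    moreover have "inflow y (n + 1) \<le> 1 + outflow y (n + 1)"
      using conjunct2[OF yb, rule_format, of "n + 1"] by simp
    ultimately have "0 \<le> ?c last_edge" unfolding lookup_completed_last by linarith
    moreover have "0 \<le> ?c (first_edge l)" for l using yb first by blast
    moreover have "0 \<le> ?c e" if "e \<in> free_edges" for e using yb free that by blast
    ultimately have "\<forall>e\<in>all_edges. 0 \<le> ?c e" unfolding all_edges_eq by blast
    then show "completed_flow y \<in> polytope" using mem by blast
  qed
qed

lemma affine_range_completed_flow: "affine (range completed_flow)"
  unfolding affine_def
proof (intro ballI allI impI)
  fix a b :: "(nat \<times> nat) \<times> nat \<Rightarrow>\<^sub>0 real" and u v :: real
  assume "a \<in> range completed_flow" "b \<in> range completed_flow" and uv: "u + v = 1"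
  then obtain y z where ab: "a = completed_flow y" "b = completed_flow z" by blast
  have "completed_flow (\<lambda>e. u * y e + v * z e) =
      (u + v) *\<^sub>R base_flow + (\<Sum>e\<in>free_edges. (u * y e + v * z e) *\<^sub>R direction e)"
    by (simp add: completed_flow_def uv)
  also have "\<dots> = u *\<^sub>R a + v *\<^sub>R b"
    by (simp add: ab completed_flow_def scaleR_add_left scaleR_add_right scaleR_sum_right sum.distrib)
  finally have "u *\<^sub>R a + v *\<^sub>R b = completed_flow (\<lambda>e. u * y e + v * z e)" by (rule sym)
  then show "u *\<^sub>R a + v *\<^sub>R b \<in> range completed_flow" by (simp only: rangeI)
qed

lemma flow_of_indicator:
  assumes "e \<in> free_edges"
  shows "inflow (\<lambda>x. (if x = e then 1 else 0) + y x) l = (if snd (ends e) = l then 1 else 0) + inflow y l"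
    and "outflow (\<lambda>x. (if x = e then 1 else 0) + y x) l = (if fst (ends e) = l then 1 else 0) + outflow y l"
proof -
  have "inflow (\<lambda>x. (if x = e then 1 else 0) + y x) l =
      (\<Sum>x\<in>free_edges. (if x = e then (if snd (ends e) = l then 1 else 0) else 0)
        + (if snd (ends x) = l then y x else 0))"
    unfolding inflow_def by (rule sum.cong) auto
  then show "inflow (\<lambda>x. (if x = e then 1 else 0) + y x) l = (if snd (ends e) = l then 1 else 0) + inflow y l"
    using assms finite_free_edges by (simp add: sum.distrib inflow_def)
  have "outflow (\<lambda>x. (if x = e then 1 else 0) + y x) l =
      (\<Sum>x\<in>free_edges. (if x = e then (if fst (ends e) = l then 1 else 0) else 0)
        + (if fst (ends x) = l then y x else 0))"
    unfolding outflow_def by (rule sum.cong) auto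
  then show "outflow (\<lambda>x. (if x = e then 1 else 0) + y x) l = (if fst (ends e) = l then 1 else 0) + outflow y l"
    using assms finite_free_edges by (simp add: sum.distrib outflow_def)
qed

lemma flow_of_zero [simp]: "inflow (\<lambda>_. 0) l = 0" "outflow (\<lambda>_. 0) l = 0"
  by (simp_all add: inflow_def outflow_def)

text \<open>
  Let \<open>v\<close> be the final vertex of \<open>e\<close>, or \<open>n + 1\<close> if that is the sink.  There are two unit flows
  along paths from source to sink, one through the edge from the source to \<open>v\<close> and one through \<open>e\<close>, that
  differ by \<open>direction e\<close>.
\<close>

lemma direction_difference:
  assumes e: "e \<in> free_edges"
  obtains f g where "f \<in> polytope" "g \<in> polytope" "direction e = f - g"
proof -
  \<comment> \<open>The free edges of the path from the final vertex of \<open>e\<close> to the sink; none if that is \<open>n + 1\<close>.\<close>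
  define y :: "(nat \<times> nat) \<times> nat \<Rightarrow> real" where
    "y = (if snd (ends e) \<le> n then (\<lambda>x. (if x = ((snd (ends e), n + 2), 0) then 1 else 0) + 0) else (\<lambda>_. 0))"
  have y: "inflow y l = (if snd (ends e) \<le> n \<and> l = n + 1 then 1 else 0)"
    "outflow y l = (if snd (ends e) \<le> n \<and> l = snd (ends e) then 1 else 0)" for l
  proof -
    have path: "((snd (ends e), n + 2), 0) \<in> free_edges" if "snd (ends e) \<le> n"
      using ends_free_edges[OF e] that by (auto simp: free_edges_def)
    show "inflow y l = (if snd (ends e) \<le> n \<and> l = n + 1 then 1 else 0)"
      using flow_of_indicator(1)[OF path, of "\<lambda>_. 0" l] by (auto simp: y_def ends_def)
    show "outflow y l = (if snd (ends e) \<le> n \<and> l = snd (ends e) then 1 else 0)"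
      using flow_of_indicator(2)[OF path, of "\<lambda>_. 0" l] by (auto simp: y_def ends_def)
  qed
  let ?z = "\<lambda>x. (if x = e then 1 else 0) + y x"
  have "completed_flow y \<in> polytope"
    unfolding completed_flow_in_polytope_iff y by (auto simp: y_def)
  moreover have "completed_flow ?z \<in> polytope"
    unfolding completed_flow_in_polytope_iff flow_of_indicator[OF e] y
    using ends_free_edges[OF e] by (auto simp: y_def)
  moreover have "direction e = completed_flow ?z - completed_flow y"
  proof -
    have "(\<Sum>x\<in>free_edges. (if x = e then 1 else 0 :: real) *\<^sub>R direction x) = direction e"
      using e finite_free_edges by (simp add: if_distrib[of "\<lambda>c. c *\<^sub>R _"] cong: if_cong)
    then show ?thesis
      by (simp add: completed_flow_def scaleR_add_left sum.distrib)
  qed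
  ultimately show thesis using that by blast
qed

lemma affine_hull_polytope: "affine hull polytope = range completed_flow"
proof
  have "polytope \<subseteq> range completed_flow"
    using polytope_iff by blast
  then show "affine hull polytope \<subseteq> range completed_flow"
    by (intro hull_minimal affine_range_completed_flow)
  show "range completed_flow \<subseteq> affine hull polytope"
  proof
    fix f assume "f \<in> range completed_flow"
    then obtain y where y: "f = completed_flow y" by blast
    have "base_flow + (\<Sum>e\<in>F. y e *\<^sub>R direction e) \<in> affine hull polytope"
      if "finite F" "F \<subseteq> free_edges" for F
      using that
    proof (induction F)
      case empty
      have "completed_flow (\<lambda>_. 0) \<in> polytope"
        unfolding completed_flow_in_polytope_iff flow_of_zero by simp
      then show ?case by (simp add: completed_flow_def hull_inc)
    next
      case (insert e F)
      obtain g h where gh: "g \<in> polytope" "h \<in> polytope" "direction e = g - h"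
        using direction_difference[of e] insert.prems by blast
      have "(base_flow + (\<Sum>e\<in>F. y e *\<^sub>R direction e)) + y e *\<^sub>R (g - h) \<in> affine hull polytope"
        using insert.IH insert.prems
        by (intro mem_affine_3_minus[OF affine_affine_hull _ hull_inc[OF gh(1)] hull_inc[OF gh(2)]]) simp
      then show ?case using insert.hyps by (simp add: gh(3) ac_simps)
    qed
    from this[OF finite_free_edges order_refl] show "f \<in> affine hull polytope"
      by (simp add: y completed_flow_def)
  qed
qed

text \<open>
  The sort key is the order in which the volume recursion adds the edges.
\<close>

definition edge_list :: "((nat \<times> nat) \<times> nat) list" where
  "edge_list = sort_key (\<lambda>e. snd (ends e)) (SOME xs. distinct xs \<and> set xs = free_edges)"

lemma edge_list: "distinct edge_list" "set edge_list = free_edges" "sorted (map (snd \<circ> ends) edge_list)"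
proof -
  have "\<exists>xs. distinct xs \<and> set xs = free_edges"
    using finite_distinct_list[OF finite_free_edges] by blast
  from someI_ex[OF this] show "distinct edge_list" "set edge_list = free_edges"
    by (auto simp: edge_list_def)
  show "sorted (map (snd \<circ> ends) edge_list)"
    unfolding edge_list_def comp_def by (rule sorted_sort_key)
qed

abbreviation num_free :: nat where
  "num_free \<equiv> length edge_list"

abbreviation flow_chart :: "(nat \<Rightarrow> real) \<Rightarrow> ((nat \<times> nat) \<times> nat \<Rightarrow>\<^sub>0 real)" where
  "flow_chart \<equiv> affine_chart num_free base_flow (\<lambda>i. direction (edge_list ! i))"

lemma sum_edge_list: "(\<Sum>e\<in>free_edges. g e) = (\<Sum>i<num_free. g (edge_list ! i))"
  using sum.reindex_bij_betw[OF bij_betw_nth[OF edge_list(1) refl edge_list(2)[symmetric]], of g]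
  by simp

lemma flow_chart_eq:
  "(\<And>i. i < num_free \<Longrightarrow> y (edge_list ! i) = x i) \<Longrightarrow> flow_chart x = completed_flow y"
  by (simp add: affine_chart_def completed_flow_def sum_edge_list)

definition edge_coord :: "(nat \<Rightarrow> real) \<Rightarrow> (nat \<times> nat) \<times> nat \<Rightarrow> real" where
  "edge_coord x e = x (inv_into {..<num_free} ((!) edge_list) e)"

lemma edge_coord_nth: "i < num_free \<Longrightarrow> edge_coord x (edge_list ! i) = x i"
  unfolding edge_coord_def
  by (subst inv_into_f_f) (auto intro: inj_on_nth edge_list(1))

lemma flow_chart_completed: "flow_chart x = completed_flow (edge_coord x)"
  by (rule flow_chart_eq) (rule edge_coord_nth)

lemma nth_edge_list_free: "i < num_free \<Longrightarrow> edge_list ! i \<in> free_edges"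
  using edge_list(2) nth_mem by blast

lemma lookup_flow_chart:
  "i < num_free \<Longrightarrow> Poly_Mapping.lookup (flow_chart x) (edge_list ! i) = x i"
  by (simp add: flow_chart_completed lookup_completed_free nth_edge_list_free edge_coord_nth)

lemma completed_flow_as_chart:
  "completed_flow y = flow_chart (\<lambda>i\<in>{..<num_free}. y (edge_list ! i))"
  by (rule flow_chart_eq[symmetric]) simp

lemma flow_chart_integral:
  assumes "\<And>i. i < num_free \<Longrightarrow> x i \<in> \<int>"
  shows "flow_chart x \<in> integer_lattice"
proof -
  have coord: "edge_coord x e \<in> \<int>" if e: "e \<in> free_edges" for e
  proof -
    obtain i where "i < num_free" "e = edge_list ! i"
      using e edge_list(2) by (metis in_set_conv_nth)
    then show ?thesis using assms edge_coord_nth by simp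
  qed
  show ?thesis
    unfolding integer_lattice_def mem_Collect_eq flow_chart_completed lookup_completed_flow
    by (intro allI Ints_add Ints_sum Ints_mult Ints_diff coord) auto
qed

text \<open>
  The coordinates of a flow are its values on the free edges; an integral choice of them completes to
  an integral flow since base flow and directions are integral.
\<close>

lemma lattice_frame_flow_chart:
  "lattice_frame integer_lattice (affine hull polytope) num_free base_flow
     (\<lambda>i. direction (edge_list ! i))"
  unfolding lattice_frame_def affine_hull_polytope
proof
  have inj: "inj_on flow_chart ({..<num_free} \<rightarrow>\<^sub>E UNIV)"
  proof (rule inj_onI)
    fix x y assume x: "x \<in> {..<num_free} \<rightarrow>\<^sub>E UNIV" and y: "y \<in> {..<num_free} \<rightarrow>\<^sub>E UNIV"
      and eq: "flow_chart x = flow_chart y"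
    show "x = y"
      by (rule PiE_ext[OF x y]) (metis eq lessThan_iff lookup_flow_chart)
  qed
  have "flow_chart ` ({..<num_free} \<rightarrow>\<^sub>E UNIV) = range completed_flow"
  proof
    show "flow_chart ` ({..<num_free} \<rightarrow>\<^sub>E UNIV) \<subseteq> range completed_flow"
      unfolding flow_chart_completed by blast
    show "range completed_flow \<subseteq> flow_chart ` ({..<num_free} \<rightarrow>\<^sub>E UNIV)"
      unfolding completed_flow_as_chart by (intro image_subsetI imageI restrict_PiE_iff[THEN iffD2]) simp
  qed
  with inj show "bij_betw flow_chart ({..<num_free} \<rightarrow>\<^sub>E UNIV) (range completed_flow)"
    by (rule bij_betw_imageI)
  show "flow_chart ` coord_lattice num_free = range completed_flow \<inter> integer_lattice"
  proof
    show "flow_chart ` coord_lattice num_free \<subseteq> range completed_flow \<inter> integer_lattice"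
    proof (intro image_subsetI IntI)
      fix x :: "nat \<Rightarrow> real" assume "x \<in> coord_lattice num_free"
      from PiE_mem[OF this] show "flow_chart x \<in> integer_lattice"
        by (intro flow_chart_integral) simp
    qed (simp add: flow_chart_completed)
    show "range completed_flow \<inter> integer_lattice \<subseteq> flow_chart ` coord_lattice num_free"
    proof
      fix f assume f: "f \<in> range completed_flow \<inter> integer_lattice"
      then obtain y where y: "f = completed_flow y" by blast
      let ?x = "\<lambda>i\<in>{..<num_free}. y (edge_list ! i)"
      have "y (edge_list ! i) \<in> \<int>" if "i < num_free" for i
      proof -
        have "\<forall>e. Poly_Mapping.lookup (completed_flow y) e \<in> \<int>"
          using f unfolding integer_lattice_def y by blast
        then show ?thesis using lookup_completed_free[OF nth_edge_list_free[OF that], of y] by metis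
      qed
      then have "?x \<in> coord_lattice num_free"
        by (intro restrict_PiE_iff[THEN iffD2]) simp
      moreover have "f = flow_chart ?x" unfolding y by (rule completed_flow_as_chart)
      ultimately show "f \<in> flow_chart ` coord_lattice num_free" by blast
    qed
  qed
qed

lemma flow_region_eq:
  "{x \<in> {..<num_free} \<rightarrow>\<^sub>E UNIV. flow_chart x \<in> polytope} =
    flow_region (map ends edge_list) (\<lambda>l. if l = n + 1 then 1 else 0)"
proof -
  have "(\<forall>e\<in>free_edges. 0 \<le> edge_coord x e) \<longleftrightarrow> (\<forall>i<num_free. 0 \<le> x i)" for x
    unfolding edge_list(2)[symmetric] all_set_conv_all_nth using edge_coord_nth by metis
  moreover have "inflow (edge_coord x) l =
      (\<Sum>i<length (map ends edge_list). if snd (map ends edge_list ! i) = l then x i else 0)" for x l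
    unfolding inflow_def sum_edge_list length_map by (rule sum.cong) (auto simp: edge_coord_nth)
  moreover have "outflow (edge_coord x) l =
      (\<Sum>i<length (map ends edge_list). if fst (map ends edge_list ! i) = l then x i else 0)" for x l
    unfolding outflow_def sum_edge_list length_map by (rule sum.cong) (auto simp: edge_coord_nth)
  ultimately show ?thesis
    unfolding flow_region_def flow_chart_completed completed_flow_in_polytope_iff by (simp only: length_map)
qed

theorem normalized_volume_eq_coeff:
  "normalized_volume integer_lattice polytope = lcoeff (edge_series (n + 1) (map ends edge_list))
     (excess_expo (n + 1) (map ends edge_list) (\<lambda>l. if l = n + 1 then num_free else 0))"
proof -
  let ?es = "map ends edge_list" and ?b = "\<lambda>l. if l = n + 1 then 1 else 0 :: real"
  let ?k = "\<lambda>l. if l = n + 1 then num_free else 0"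
  have es: "u < v \<and> v \<le> n + 1" if "(u, v) \<in> set ?es" for u v
    using that edge_list(2) ends_free_edges(3,4) by (metis fst_conv imageE list.set_map snd_conv)
  have sorted: "sorted (map snd ?es)" using edge_list(3) by simp
  have "emeasure (coord_measure num_free) (flow_region ?es ?b) =
      ennreal (real (count (monomials ?es) ?k) / fact num_free)"
  proof -
    have "(\<Sum>j\<in>#monomials ?es. monomial_value (n + 1) j ?b) =
        real (count (monomials ?es) ?k) / fact num_free"
      using sum_monomial_values_at_sink[of ?es "n + 1", OF es] by (simp only: length_map)
    moreover have "0 \<le> ?b l" for l by simp
    ultimately show ?thesis
      using emeasure_flow_region[of ?es "n + 1" ?b, OF sorted es] by (simp only: length_map)
  qed
  then have vol: "measure (coord_measure num_free) (flow_region ?es ?b) =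
      real (count (monomials ?es) ?k) / fact num_free"
    by (simp add: measure_def)
  have "normalized_volume integer_lattice polytope =
      fact num_free * measure (coord_measure num_free) (flow_region ?es ?b)"
    using flow_region_measurable[of ?es ?b]
    by (intro normalized_volume_eq[OF lattice_frame_flow_chart flow_region_eq[symmetric]]) simp
  also have "\<dots> = real (count (monomials ?es) ?k)" unfolding vol by simp
  also have "\<dots> = lcoeff (edge_series (n + 1) ?es) (excess_expo (n + 1) ?es ?k)"
    using sorted es by (intro count_monomials_eq_coeff) auto
  finally show ?thesis .
qed

end

section \<open>The constant term\<close>

lemma lcoeff_fold_CT:
  "lcoeff (fold CT ks F) a = (if \<forall>i\<in>set ks. Poly_Mapping.lookup a i = 0 then lcoeff F a else 0)"
  by (induction ks arbitrary: F) (auto simp: CT.rep_eq)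

lemma lmonom_0: "lmonom 0 = (1 :: 'a::comm_ring_1 laurent)"
  by (simp add: one_laurent_def)

lemma lmonom_add: "lmonom (a + b) = (lmonom a * lmonom b :: 'a::comm_ring_1 laurent)"
  by (rule laurent_eqI) (simp add: coeff_monom_times lmonom.rep_eq eq_diff_eq' algebra_simps)

lemma lmonom_sum: "lmonom (\<Sum>i\<in>A. f i) = (\<Prod>i\<in>A. lmonom (f i) :: 'a::comm_ring_1 laurent)"
  by (induction A rule: infinite_finite_induct) (simp_all add: lmonom_0 lmonom_add)

lemma edge_series_prod_mset:
  "edge_series N es = (\<Prod>e\<in>#mset es. geom_series (edge_expo N e 1))"
  by (induction es) (simp_all add: edge_series_def)

context source_sink_graph
begin

lemma mset_ends: "mset (map ends edge_list) = G + image_mset (\<lambda>i. (i, n + 1)) (mset_set {1..n})"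
proof -
  have G_part: "image_mset ends (mset_set (edge_set G)) = G"
  proof -
    have "image_mset ends (mset_set (edge_set G)) = image_mset fst (mset_set (edge_set G))"
    proof (rule image_mset_cong)
      fix e assume "e \<in># mset_set (edge_set G)"
      then have "snd (fst e) \<le> n + 1" using edge_set_G(3) finite_edge_set by simp
      then show "ends e = fst e" by (simp add: ends_def min_def prod_eq_iff)
    qed
    then show ?thesis by (simp only: image_mset_fst_edge_set)
  qed
  have inj: "inj_on (\<lambda>i. ((i, n + 2), 0 :: nat)) {1..n}" by (simp add: inj_on_def)
  have disj: "edge_set G \<inter> (\<lambda>i. ((i, n + 2), 0)) ` {1..n} = {}"
    using edge_set_G(3) by fastforce
  have "mset edge_list = mset_set free_edges"
    using mset_set_set[OF edge_list(1)] by (simp only: edge_list(2))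
  also have "\<dots> = mset_set (edge_set G) + image_mset (\<lambda>i. ((i, n + 2), 0)) (mset_set {1..n})"
    unfolding free_edges_def image_mset_mset_set[OF inj]
    by (rule mset_set_Union[OF finite_edge_set _ disj]) simp
  finally have "mset (map ends edge_list) =
      G + image_mset ends (image_mset (\<lambda>i. ((i, n + 2), 0)) (mset_set {1..n}))"
    by (simp only: mset_map image_mset_union G_part)
  then show ?thesis by (simp add: ends_def image_mset.compositionality comp_def)
qed

lemma G_partition: "filter_mset (\<lambda>(i, j). j = n + 1) G + filter_mset (\<lambda>(i, j). j \<le> n) G = G"
proof -
  have "filter_mset (\<lambda>(i, j). j \<le> n) G = filter_mset (\<lambda>x. \<not> (\<lambda>(i, j). j = n + 1) x) G"
    using multigraph by (intro filter_mset_cong) (auto simp: multigraph_on_def)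
  then show ?thesis by (simp only: multiset_partition[symmetric])
qed

lemma edge_series_factors:
  "edge_series (n + 1) (map ends edge_list) =
    (\<Prod>i=1..n. geom_series (xpow i 1)) *
    (\<Prod>(i, j)\<in>#filter_mset (\<lambda>(i, j). j = n + 1) G. geom_series (xpow i 1)) *
    (\<Prod>(i, j)\<in>#filter_mset (\<lambda>(i, j). j \<le> n) G. geom_series (xpow i 1 - xpow j 1))"
proof -
  let ?g = "\<lambda>e. geom_series (edge_expo (n + 1) e 1) :: real laurent"
  have "edge_series (n + 1) (map ends edge_list) =
      (\<Prod>e\<in>#filter_mset (\<lambda>(i, j). j = n + 1) G + filter_mset (\<lambda>(i, j). j \<le> n) G. ?g e) *
      (\<Prod>i=1..n. ?g (i, n + 1))"
    unfolding edge_series_prod_mset mset_ends G_partition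
    by (simp add: image_mset.compositionality comp_def prod_unfold_prod_mset)
  also have "\<dots> = (\<Prod>e\<in>#filter_mset (\<lambda>(i, j). j = n + 1) G. ?g e) *
      (\<Prod>e\<in>#filter_mset (\<lambda>(i, j). j \<le> n) G. ?g e) * (\<Prod>i=1..n. ?g (i, n + 1))"
    by (simp only: image_mset_union prod_mset.union)
  also have "(\<Prod>e\<in>#filter_mset (\<lambda>(i, j). j = n + 1) G. ?g e) =
      (\<Prod>(i, j)\<in>#filter_mset (\<lambda>(i, j). j = n + 1) G. geom_series (xpow i 1))"
    by (intro arg_cong[of _ _ prod_mset] image_mset_cong) (auto simp: edge_expo_def)
  also have "(\<Prod>e\<in>#filter_mset (\<lambda>(i, j). j \<le> n) G. ?g e) =
      (\<Prod>(i, j)\<in>#filter_mset (\<lambda>(i, j). j \<le> n) G. geom_series (xpow i 1 - xpow j 1))"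
    by (intro arg_cong[of _ _ prod_mset] image_mset_cong) (auto simp: edge_expo_def)
  also have "(\<Prod>i=1..n. ?g (i, n + 1)) = (\<Prod>i=1..n. geom_series (xpow i 1))"
    by (simp add: edge_expo_def)
  finally show ?thesis by (simp only: ac_simps)
qed

lemma size_restrict_edges: "size (restrict_edges G {1..k}) = size (filter_mset (\<lambda>(i, j). j \<le> k) G)"
proof -
  have "restrict_edges G {1..k} = filter_mset (\<lambda>(i, j). j \<le> k) G"
    unfolding restrict_edges_def
    using multigraph by (intro filter_mset_cong) (auto simp: multigraph_on_def)
  then show ?thesis by simp
qed

lemma indegree_ends:
  assumes "l < n + 1"
  shows "indegree (map ends edge_list) l = size (filter_mset (\<lambda>(i, j). j = l) G)"
proof -
  have "indegree (map ends edge_list) l = size (filter_mset (\<lambda>e. snd e = l) (mset (map ends edge_list)))"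
    unfolding indegree_def by (simp only: mset_filter[symmetric] size_mset)
  also have "filter_mset (\<lambda>e. snd e = l) (mset (map ends edge_list)) = filter_mset (\<lambda>e. snd e = l) G"
    unfolding mset_ends filter_union_mset using assms by (simp add: filter_mset_image_mset)
  finally show ?thesis by (simp add: case_prod_beta')
qed

text \<open>
  Edges ascend, so \<open>G[l]\<close> consists of the edges with final vertex at most \<open>l\<close>, and no edge of \<open>G\<close> ends at
  the vertices 0 and 1.
\<close>

lemma int_indegree_ends:
  assumes "l < n + 1"
  shows "int (indegree (map ends edge_list) l) = (if l \<in> {2..n} then edge_increment G (l - 1) else 0)"
proof (cases "2 \<le> l")
  case True
  have "filter_mset (\<lambda>(i, j). j \<le> l) G =
      filter_mset (\<lambda>(i, j). j \<le> l - 1) G + filter_mset (\<lambda>(i, j). j = l) G"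
    using True by (induction G) auto
  then have "size (restrict_edges G {1..l}) =
      size (restrict_edges G {1..l - 1}) + indegree (map ends edge_list) l"
    unfolding size_restrict_edges indegree_ends[OF assms] by (metis size_union)
  moreover have "l - 1 + 1 = l" using True by simp
  ultimately show ?thesis
    using True assms by (simp only: edge_increment_def) simp
next
  case False
  have "filter_mset (\<lambda>(i, j). j = l) G = filter_mset (\<lambda>_. False) G"
    using multigraph False by (intro filter_mset_cong) (auto simp: multigraph_on_def)
  then show ?thesis using False assms by (simp add: indegree_ends)
qed

lemma edge_series_ends_support:
  assumes "lcoeff (edge_series (n + 1) (map ends edge_list)) c \<noteq> 0" "l \<notin> {1..n}"
  shows "Poly_Mapping.lookup c l = 0"
proof -
  let ?es = "map ends edge_list"
  have ends: "1 \<le> fst e" "fst e \<le> n" "fst e < snd e" if "e \<in> set ?es" for e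
    using that edge_list(2) ends_free_edges by auto
  have src: "l \<notin> fst ` set ?es"
  proof
    assume "l \<in> fst ` set ?es"
    then obtain e where "l = fst e" "e \<in> set ?es" by (rule imageE)
    with ends[of e] assms(2) show False by simp
  qed
  have tgt: "l \<notin> snd ` set ?es \<or> n + 1 \<le> l"
  proof (rule disjCI)
    assume "\<not> n + 1 \<le> l"
    then have "l = 0" using assms(2) by auto
    show "l \<notin> snd ` set ?es"
    proof
      assume "l \<in> snd ` set ?es"
      then obtain e where "l = snd e" "e \<in> set ?es" by (rule imageE)
      with ends(3)[of e] \<open>l = 0\<close> show False by simp
    qed
  qed
  have "u < v" if "(u, v) \<in> set ?es" for u v
    using ends(3)[OF that] by simp
  from edge_series_support(3)[OF this assms(1) src tgt] show ?thesis .
qed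

end

theorem theorem6:
  fixes n :: nat and G :: "(nat \<times> nat) multiset"
  assumes "n \<ge> 1"
    and "multigraph_on {1..n + 1} G"
    and "\<And>i j. count G (i, j) > 1 \<Longrightarrow> i = 1"
  shows "const_series (normalized_volume integer_lattice
            (flow_polytope {0..n + 2} (extended_graph n G))) =
         fold CT [1..<n + 1]
           ((\<Prod>i=1..n. geom_series (xpow i 1)) *
            (\<Prod>(i, j)\<in>#filter_mset (\<lambda>(i, j). j = n + 1) G. geom_series (xpow i 1)) *
            (\<Prod>i=2..n. lmonom (xpow i (- edge_increment G (i - 1)))) *
            (\<Prod>(i, j)\<in>#filter_mset (\<lambda>(i, j). j \<le> n) G. geom_series (xpow i 1 - xpow j 1)))"
    (is "const_series ?vol = fold CT _ ?S")
proof -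
  interpret source_sink_graph n G by standard (rule assms(2))
  define F where "F = edge_series (n + 1) (map ends edge_list)"
  define m where "m = (\<Sum>i=2..n. xpow i (- edge_increment G (i - 1)))"
  have S: "?S = lmonom m * F"
    unfolding F_def edge_series_factors m_def lmonom_sum by (simp only: ac_simps)
  have m: "Poly_Mapping.lookup m l = (if l \<in> {2..n} then - edge_increment G (l - 1) else 0)" for l
    by (simp add: m_def lookup_sum lookup_single when_def)
  have "0 - m = excess_expo (n + 1) (map ends edge_list) (\<lambda>l. if l = n + 1 then num_free else 0)"
    by (rule poly_mapping_eqI) (auto simp: lookup_minus m lookup_excess_expo int_indegree_ends)
  then have vol: "?vol = lcoeff ?S 0"
    unfolding S coeff_monom_times F_def by (simp only: normalized_volume_eq_coeff)
  have support: "Poly_Mapping.lookup a l = 0" if "lcoeff ?S a \<noteq> 0" "l \<notin> {1..n}" for a l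
  proof -
    have "Poly_Mapping.lookup (a - m) l = 0"
      using edge_series_ends_support[of "a - m" l] that unfolding S coeff_monom_times F_def by blast
    then show ?thesis using that(2) by (auto simp: lookup_minus m)
  qed
  show ?thesis
  proof (rule laurent_eqI)
    fix a
    show "lcoeff (const_series ?vol) a = lcoeff (fold CT [1..<n + 1] ?S) a"
    proof (cases "a = 0")
      case True
      then show ?thesis unfolding lcoeff_fold_CT coeff_const_series vol by simp
    next
      case False
      have "lcoeff ?S a = 0" if "\<forall>i\<in>set [1..<n + 1]. Poly_Mapping.lookup a i = 0"
      proof (rule ccontr)
        assume nz: "lcoeff ?S a \<noteq> 0"
        have "set [1..<n + 1] = {1..n}" by auto
        then have "Poly_Mapping.lookup a l = 0" for l
          using support[OF nz, of l] that by metis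
        then have "a = 0" by (intro poly_mapping_eqI) simp
        with False show False ..
      qed
      then show ?thesis unfolding lcoeff_fold_CT coeff_const_series using False by simp
    qed
  qed
qed

end
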